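(* There exists a unique bounded linear operator $$\mathcal F : H^{1/2}(\Gamma,\mathbb R^d) \to H^1_D(\Omega,\mathbb R^d)^\perp \quad\text{such that}\quad T_0 \mathcal F g = g \text{ on } \Gamma_D \quad \text{for every } g \in H^{1/2}(\Gamma,\mathbb R^d),$$ where $H^1_D(\Omega,\mathbb R^d)^\perp$ is the orthogonal complement of $H^1_D(\Omega,\mathbb R^d)$ in $H^1(\Omega,\mathbb R^d)$.
   Context: Let $d\ge 1$, let $\Omega\subset\mathbb R^d$ be a bounded domain (open and connected) with Lipschitz boundary $\Gamma=\partial\Omega$, and let $\Gamma_D,\Gamma_N\subseteq\Gamma$ be relatively open in $\Gamma$ with $\Gamma=\overline{\Gamma_D}\cup\overline{\Gamma_N}$ and $\Gamma_D\cap\Gamma_N=\emptyset$ (either may be empty). $H^1(\Omega,\mathbb R^d)$ carries the scalar product $(u,v)_{L^2(\Omega,\mathbb R^d)}+(\operatorname{grad}u,\operatorname{grad}v)_{L^2(\Omega,\mathbb R^{d\times d})}$, where $(\operatorname{grad}u)_{ij}=\partial_j u_i$ and matrices carry the Frobenius product. $T_0:H^1(\Omega,\mathbb R^d)\to H^{1/2}(\Gamma,\mathbb R^d)$ is the Dirichlet trace map, i.e. the bounded linear map with $T_0u=u|_\Gamma$ for $u\in C^1(\overline\Omega,\mathbb R^d)$; $H^{1/2}(\Gamma,\mathbb R^d)\subset L^2(\Gamma,\mathbb R^d)$ is defined as its range, with its usual Hilbert space topology (for which $T_0$ is a bounded surjection), and $\ker T_0=H^1_0(\Omega,\mathbb R^d)$.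 Finally $H^1_D(\Omega,\mathbb R^d)=\{u\in H^1(\Omega,\mathbb R^d): T_0u=0 \text{ on }\Gamma_D\}$, a closed subspace. Equalities on $\Gamma_D$ are meant almost everywhere. *)

theory Defs
  imports "HOL-Analysis.Analysis"
begin

section \<open>Spaces of functions modulo almost everywhere equality\<close>

text \<open>
  The elements of \<open>L\<^sup>2\<close>, \<open>H\<^sup>1\<close> and \<open>H\<^bsup>1/2\<^esup>\<close> are represented by functions; two representatives
  denote the same element iff they agree almost everywhere for \<open>base\<close>. The values of a
  representative outside \<open>space base\<close> are irrelevant.
\<close>

record ('a, 'b) ip_space =
  carr :: "('a \<Rightarrow> 'b) set"
  base :: "'a measure"
  ip :: "('a \<Rightarrow> 'b) \<Rightarrow> ('a \<Rightarrow> 'b) \<Rightarrow> real"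

definition eqv :: "('a, 'b) ip_space \<Rightarrow> ('a \<Rightarrow> 'b) \<Rightarrow> ('a \<Rightarrow> 'b) \<Rightarrow> bool" where
  "eqv X f g \<longleftrightarrow> (AE x in base X. f x = g x)"

definition nrm :: "('a, 'b) ip_space \<Rightarrow> ('a \<Rightarrow> 'b) \<Rightarrow> real" where
  "nrm X f = sqrt (ip X f f)"

definition hilbert_space :: "('a, 'b::real_vector) ip_space \<Rightarrow> bool" where
  "hilbert_space X \<longleftrightarrow>
    (\<lambda>x. 0) \<in> carr X \<and>
    (\<forall>f\<in>carr X. \<forall>g\<in>carr X. \<forall>a b. (\<lambda>x. a *\<^sub>R f x + b *\<^sub>R g x) \<in> carr X) \<and>
    (\<forall>f\<in>carr X. \<forall>g\<in>carr X. ip X f g = ip X g f) \<and>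
    (\<forall>f\<in>carr X. \<forall>g\<in>carr X. \<forall>h\<in>carr X. \<forall>a b.
        ip X (\<lambda>x. a *\<^sub>R f x + b *\<^sub>R g x) h = a * ip X f h + b * ip X g h) \<and>
    (\<forall>f\<in>carr X. 0 \<le> ip X f f) \<and>
    (\<forall>f\<in>carr X. ip X f f = 0 \<longleftrightarrow> eqv X f (\<lambda>x. 0)) \<and>
    (\<forall>s. (\<forall>n::nat. s n \<in> carr X) \<longrightarrow>
         (\<forall>e>0. \<exists>N. \<forall>m\<ge>N. \<forall>n\<ge>N. nrm X (\<lambda>x. s m x - s n x) < e) \<longrightarrow>
         (\<exists>f\<in>carr X. (\<lambda>n. nrm X (\<lambda>x. s n x - f x)) \<longlonglongrightarrow> 0))"

definition bounded_operator ::
  "('a, 'b::real_vector) ip_space \<Rightarrow> ('c, 'd::real_vector) ip_space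
    \<Rightarrow> (('a \<Rightarrow> 'b) \<Rightarrow> ('c \<Rightarrow> 'd)) \<Rightarrow> bool" where
  "bounded_operator X Y F \<longleftrightarrow>
    (\<forall>f\<in>carr X. F f \<in> carr Y) \<and>
    (\<forall>f\<in>carr X. \<forall>g\<in>carr X. eqv X f g \<longrightarrow> eqv Y (F f) (F g)) \<and>
    (\<forall>f\<in>carr X. \<forall>g\<in>carr X. \<forall>a b.
        eqv Y (F (\<lambda>x. a *\<^sub>R f x + b *\<^sub>R g x)) (\<lambda>x. a *\<^sub>R F f x + b *\<^sub>R F g x)) \<and>
    (\<exists>C. \<forall>f\<in>carr X. nrm Y (F f) \<le> C * nrm X f)"

definition orth_compl :: "('a, 'b) ip_space \<Rightarrow> ('a \<Rightarrow> 'b) set \<Rightarrow> ('a \<Rightarrow> 'b) set" where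
  "orth_compl X S = {f \<in> carr X. \<forall>g\<in>S. ip X f g = 0}"

definition L2 :: "'a measure \<Rightarrow> ('a, 'b::euclidean_space) ip_space" where
  "L2 M = \<lparr> carr = {f \<in> borel_measurable M. integrable M (\<lambda>x. (norm (f x))\<^sup>2)},
            base = M,
            ip = (\<lambda>f g. \<integral>x. f x \<bullet> g x \<partial>M) \<rparr>"


section \<open>The Sobolev space \<open>H\<^sup>1\<close>\<close>

definition partial :: "'n \<Rightarrow> (real^'n \<Rightarrow> real) \<Rightarrow> real^'n \<Rightarrow> real" where
  "partial j f x = frechet_derivative f (at x) (axis j 1)"

primrec C_k :: "nat \<Rightarrow> (real^'n \<Rightarrow> real) \<Rightarrow> bool" where
  "C_k 0 f \<longleftrightarrow> continuous_on UNIV f"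
| "C_k (Suc k) f \<longleftrightarrow> (\<forall>x. f differentiable (at x)) \<and> (\<forall>j. C_k k (partial j f))"

definition test_function :: "(real^'n) set \<Rightarrow> (real^'n \<Rightarrow> real) \<Rightarrow> bool" where
  "test_function \<Omega> \<phi> \<longleftrightarrow>
    (\<forall>k. C_k k \<phi>) \<and> compact (closure {x. \<phi> x \<noteq> 0}) \<and> closure {x. \<phi> x \<noteq> 0} \<subseteq> \<Omega>"

definition weak_grad ::
  "(real^'n) set \<Rightarrow> (real^'n \<Rightarrow> real^'n) \<Rightarrow> (real^'n \<Rightarrow> real^'n^'n) \<Rightarrow> bool" where
  "weak_grad \<Omega> u G \<longleftrightarrow>
    G \<in> carr (L2 (lebesgue_on \<Omega>)) \<and>
    (\<forall>\<phi> i j. test_function \<Omega> \<phi> \<longrightarrow>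
      (\<integral>x. u x $ i * partial j \<phi> x \<partial>lebesgue_on \<Omega>) = - (\<integral>x. G x $ i $ j * \<phi> x \<partial>lebesgue_on \<Omega>))"

text \<open>
  The weak gradient is unique up to a null set, so the choice does not affect \<open>ip (H1 \<Omega>)\<close>.
  The inner product on \<^typ>\<open>real^'n^'n\<close> is the Frobenius product.
\<close>

definition grad :: "(real^'n) set \<Rightarrow> (real^'n \<Rightarrow> real^'n) \<Rightarrow> real^'n \<Rightarrow> real^'n^'n" where
  "grad \<Omega> u = (SOME G. weak_grad \<Omega> u G)"

definition H1 :: "(real^'n) set \<Rightarrow> (real^'n, real^'n) ip_space" where
  "H1 \<Omega> = \<lparr> carr = {u \<in> carr (L2 (lebesgue_on \<Omega>)). \<exists>G. weak_grad \<Omega> u G},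
            base = lebesgue_on \<Omega>,
            ip = (\<lambda>u v. ip (L2 (lebesgue_on \<Omega>)) u v + ip (L2 (lebesgue_on \<Omega>)) (grad \<Omega> u) (grad \<Omega> v)) \<rparr>"


section \<open>Lipschitz boundary and surface measure\<close>

text \<open>
  Near each boundary point, \<open>\<Omega>\<close> is the strict epigraph, in some direction \<open>e\<close>, of a Lipschitz
  function on the hyperplane orthogonal to \<open>e\<close>.
\<close>

definition lipschitz_boundary :: "(real^'n) set \<Rightarrow> bool" where
  "lipschitz_boundary \<Omega> \<longleftrightarrow>
    (\<forall>p\<in>frontier \<Omega>. \<exists>r>0. \<exists>e. \<exists>\<gamma>::real^'n \<Rightarrow> real. \<exists>L.
       norm e = 1 \<and> L-lipschitz_on {y. y \<bullet> e = 0} \<gamma> \<and>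
       \<Omega> \<inter> ball p r = {x \<in> ball p r. \<gamma> (x - (x \<bullet> e) *\<^sub>R e) < x \<bullet> e})"

text \<open>
  Only bounded covering sets are allowed because \<^const>\<open>diameter\<close> is unspecified on unbounded
  sets; the empty set costs nothing also for \<open>k = 0\<close>, where \<open>0 ^ 0 = 1\<close>.
\<close>

definition hausdorff_cost :: "nat \<Rightarrow> 'a::metric_space set \<Rightarrow> real" where
  "hausdorff_cost k C = (if C = {} then 0 else unit_ball_vol (real k) * (diameter C / 2) ^ k)"

definition hausdorff_outer :: "nat \<Rightarrow> 'a::metric_space set \<Rightarrow> ennreal" where
  "hausdorff_outer k A =
    (SUP \<delta>\<in>{0::real<..}.
      INF C\<in>{C::nat \<Rightarrow> 'a set. A \<subseteq> (\<Union>i. C i) \<and> (\<forall>i. bounded (C i) \<and> diameter (C i) \<le> \<delta>)}.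
        \<Sum>i. ennreal (hausdorff_cost k (C i)))"

text \<open>
  \<^const>\<open>hausdorff_outer\<close> is a metric outer measure, hence countably additive on the Borel sets,
  so \<^const>\<open>measure_of\<close> does not fall back to the zero measure here.
\<close>

definition hausdorff_measure :: "nat \<Rightarrow> 'a::metric_space measure" where
  "hausdorff_measure k = measure_of UNIV (sets borel) (hausdorff_outer k)"

definition surface_measure :: "(real^'n) set \<Rightarrow> (real^'n) measure" where
  "surface_measure \<Gamma> = restrict_space (hausdorff_measure (CARD('n) - 1)) \<Gamma>"


section \<open>Trace map and the associated spaces\<close>

definition C1_closure :: "(real^'n) set \<Rightarrow> (real^'n \<Rightarrow> real^'n) \<Rightarrow> bool" where
  "C1_closure \<Omega> u \<longleftrightarrow>
    continuous_on (closure \<Omega>) u \<and>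
    (\<exists>G. continuous_on (closure \<Omega>) G \<and>
         (\<forall>x\<in>\<Omega>. (u has_derivative (\<lambda>h. (G x :: real^'n^'n) *v h)) (at x)))"

definition trace_map ::
  "(real^'n) set \<Rightarrow> ((real^'n \<Rightarrow> real^'n) \<Rightarrow> (real^'n \<Rightarrow> real^'n)) \<Rightarrow> bool" where
  "trace_map \<Omega> T \<longleftrightarrow>
    bounded_operator (H1 \<Omega>) (L2 (surface_measure (frontier \<Omega>))) T \<and>
    (\<forall>u\<in>carr (H1 \<Omega>). C1_closure \<Omega> u \<longrightarrow> (AE x in surface_measure (frontier \<Omega>). T u x = u x))"

text \<open>
  \<open>H\<^bsup>1/2\<^esup>\<close> is the range of the trace map \<open>T\<close> inside \<open>L\<^sup>2\<close> of the boundary, with a Hilbert space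
  structure making \<open>T\<close> a bounded surjection. By the open mapping theorem any two such structures
  have equivalent norms, so the topology is determined.
\<close>

definition trace_space ::
  "(real^'n) set \<Rightarrow> ((real^'n \<Rightarrow> real^'n) \<Rightarrow> (real^'n \<Rightarrow> real^'n))
    \<Rightarrow> (real^'n, real^'n) ip_space \<Rightarrow> bool" where
  "trace_space \<Omega> T Hh \<longleftrightarrow>
    base Hh = surface_measure (frontier \<Omega>) \<and>
    carr Hh = {g \<in> carr (L2 (surface_measure (frontier \<Omega>))).
                 \<exists>u\<in>carr (H1 \<Omega>). AE x in surface_measure (frontier \<Omega>). g x = T u x} \<and>
    hilbert_space Hh \<and>
    bounded_operator (H1 \<Omega>) Hh T"

definition H1_D ::
  "(real^'n) set \<Rightarrow> ((real^'n \<Rightarrow> real^'n) \<Rightarrow> (real^'n \<Rightarrow> real^'n)) \<Rightarrow> (real^'n) set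
    \<Rightarrow> (real^'n \<Rightarrow> real^'n) set" where
  "H1_D \<Omega> T \<Gamma>D =
    {u \<in> carr (H1 \<Omega>). AE x in surface_measure (frontier \<Omega>). x \<in> \<Gamma>D \<longrightarrow> T u x = 0}"

definition H1_D_perp ::
  "(real^'n) set \<Rightarrow> ((real^'n \<Rightarrow> real^'n) \<Rightarrow> (real^'n \<Rightarrow> real^'n)) \<Rightarrow> (real^'n) set
    \<Rightarrow> (real^'n, real^'n) ip_space" where
  "H1_D_perp \<Omega> T \<Gamma>D = (H1 \<Omega>) \<lparr> carr := orth_compl (H1 \<Omega>) (H1_D \<Omega> T \<Gamma>D) \<rparr>"

definition dirichlet_lifting ::
  "(real^'n) set \<Rightarrow> ((real^'n \<Rightarrow> real^'n) \<Rightarrow> (real^'n \<Rightarrow> real^'n)) \<Rightarrow> (real^'n) set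
    \<Rightarrow> (real^'n, real^'n) ip_space \<Rightarrow> ((real^'n \<Rightarrow> real^'n) \<Rightarrow> (real^'n \<Rightarrow> real^'n)) \<Rightarrow> bool" where
  "dirichlet_lifting \<Omega> T \<Gamma>D Hh F \<longleftrightarrow>
    bounded_operator Hh (H1_D_perp \<Omega> T \<Gamma>D) F \<and>
    (\<forall>g\<in>carr Hh. AE x in surface_measure (frontier \<Omega>). x \<in> \<Gamma>D \<longrightarrow> T (F g) x = g x)"

end

theory Submission
  imports Defs "HOL-Library.Function_Algebras"
begin

text \<open>
  Write \<open>H\<close> for \<open>H\<^sup>1(\<Omega>)\<close> and \<open>D\<close> for \<open>H\<^sup>1\<^sub>D\<close>. Everything happens in Hilbert space: a boundary value \<open>g\<close> is the
  trace of some \<open>u \<in> H\<close>, and if \<open>P\<close> is the orthogonal projection onto \<open>D\<close>, then \<open>u - P u\<close> is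
  orthogonal to \<open>D\<close> and still has trace \<open>g\<close> on \<open>\<Gamma>D\<close>. Two such liftings of \<open>g\<close> differ by an element of
  \<open>D\<close> orthogonal to \<open>D\<close>, which is zero; this is \<open>lifts_unique\<close>. It yields at once that the lifting
  is well defined, linear and unique. Moreover, the lifting is the element of least norm among all
  \<open>u\<close> with trace \<open>g\<close> on \<open>\<Gamma>D\<close> (\<open>lifts_minimal\<close>), so it is bounded as soon as every \<open>g\<close> has some preimage \<open>u\<close>
  with \<open>\<parallel>u\<parallel> \<le> c \<parallel>g\<parallel>\<close>. That is the open mapping theorem for the trace map, which is a bounded
  surjection onto \<open>H\<^bsup>1/2\<^esup>\<close>.

  Three facts support this. First, \<open>H\<close> is a Hilbert space (\<open>H1_semi_hilbert\<close>). Completeness comes from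
  the Riesz-Fischer theorem for \<open>L\<^sup>2\<close> and the closedness of the weak gradient. Bilinearity of the
  inner product already needs the weak gradient to be unique almost everywhere
  (\<open>weak_grad_unique\<close>), hence a supply of smooth compactly supported functions rich enough to
  approximate the indicator of every open set. Second, \<open>D\<close> is closed in \<open>H\<close> (\<open>H1_D_closed\<close>), because the
  trace is bounded into \<open>L\<^sup>2\<close> of the boundary. Third, the projection theorem and the open mapping
  theorem are proved for semidefinite inner products, since elements of the function spaces are
  represented by functions and a seminorm only determines them up to null sets.
\<close>

section \<open>Functions as vectors\<close>

instantiation "fun" :: (type, real_vector) real_vector
begin

definition scaleR_fun :: "real \<Rightarrow> ('a \<Rightarrow> 'b) \<Rightarrow> 'a \<Rightarrow> 'b" where
  "scaleR_fun c f = (\<lambda>x. c *\<^sub>R f x)"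

instance
  by standard (auto simp: scaleR_fun_def fun_eq_iff scaleR_add_right scaleR_add_left)

end

lemma scaleR_fun_apply [simp]: "(c *\<^sub>R f) x = c *\<^sub>R f x" for f :: "'a \<Rightarrow> 'b::real_vector"
  by (simp add: scaleR_fun_def)

section \<open>Semidefinite inner products\<close>

lemma nonneg_quadratic_imp_zero:
  fixes a b :: real
  assumes "\<And>t. 0 \<le> t\<^sup>2 * a - 2 * t * b" and "0 \<le> a"
  shows "b = 0"
proof (rule ccontr)
  assume "b \<noteq> 0"
  define t where "t = b / (a + 1)"
  have b: "b = t * (a + 1)" and "t \<noteq> 0" using \<open>b \<noteq> 0\<close> assms(2) by (simp_all add: t_def)
  have "0 \<le> t\<^sup>2 * a - 2 * t * b" by (rule assms)
  also have "\<dots> = - (t\<^sup>2 * (a + 2))" by (simp add: b power2_eq_square algebra_simps)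
  also have "\<dots> < 0" using \<open>t \<noteq> 0\<close> assms(2) by simp
  finally show False by simp
qed

text \<open>
  The inner product may vanish on nonzero vectors: the vectors will be functions, and those that
  vanish almost everywhere have norm zero. All statements are therefore modulo vectors of norm zero.
\<close>

locale semi_inner =
  fixes V :: "'v::real_vector set" and ip :: "'v \<Rightarrow> 'v \<Rightarrow> real"
  assumes subspace_V: "subspace V"
    and ip_commute: "x \<in> V \<Longrightarrow> y \<in> V \<Longrightarrow> ip x y = ip y x"
    and ip_add_left: "x \<in> V \<Longrightarrow> y \<in> V \<Longrightarrow> z \<in> V \<Longrightarrow> ip (x + y) z = ip x z + ip y z"
    and ip_scale_left: "x \<in> V \<Longrightarrow> z \<in> V \<Longrightarrow> ip (c *\<^sub>R x) z = c * ip x z"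
    and ip_nonneg: "x \<in> V \<Longrightarrow> 0 \<le> ip x x"
begin

definition N :: "'v \<Rightarrow> real" where "N x = sqrt (ip x x)"

lemma V_zero [simp, intro]: "0 \<in> V"
  and V_add [simp, intro]: "x \<in> V \<Longrightarrow> y \<in> V \<Longrightarrow> x + y \<in> V"
  and V_scale [simp, intro]: "x \<in> V \<Longrightarrow> c *\<^sub>R x \<in> V"
  and V_diff [simp, intro]: "x \<in> V \<Longrightarrow> y \<in> V \<Longrightarrow> x - y \<in> V"
  using subspace_V by (auto simp: subspace_0 subspace_add subspace_scale subspace_diff)

lemma V_minus [simp, intro]: "x \<in> V \<Longrightarrow> - x \<in> V"
  using V_scale[of x "-1"] by simp

lemma ip_add_right: "x \<in> V \<Longrightarrow> y \<in> V \<Longrightarrow> z \<in> V \<Longrightarrow> ip z (x + y) = ip z x + ip z y"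
  using ip_add_left ip_commute V_add by metis

lemma ip_scale_right: "x \<in> V \<Longrightarrow> z \<in> V \<Longrightarrow> ip z (c *\<^sub>R x) = c * ip z x"
  using ip_scale_left ip_commute V_scale by metis

lemma ip_diff_left: "x \<in> V \<Longrightarrow> y \<in> V \<Longrightarrow> z \<in> V \<Longrightarrow> ip (x - y) z = ip x z - ip y z"
  using ip_add_left[of x "(-1) *\<^sub>R y" z] ip_scale_left[of y z "-1"] V_scale[of y "-1"] by simp

lemma ip_diff_right: "x \<in> V \<Longrightarrow> y \<in> V \<Longrightarrow> z \<in> V \<Longrightarrow> ip z (x - y) = ip z x - ip z y"
  using ip_diff_left ip_commute V_diff by metis

lemmas ip_simps = ip_add_left ip_add_right ip_scale_left ip_scale_right ip_diff_left ip_diff_right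

lemma ip_lincomb_left:
  "x \<in> V \<Longrightarrow> y \<in> V \<Longrightarrow> z \<in> V \<Longrightarrow> ip (a *\<^sub>R x + b *\<^sub>R y) z = a * ip x z + b * ip y z"
  by (simp add: ip_add_left ip_scale_left)

lemma V_lincomb: "x \<in> V \<Longrightarrow> y \<in> V \<Longrightarrow> a *\<^sub>R x + b *\<^sub>R y \<in> V"
  by simp

lemma N_nonneg [simp]: "x \<in> V \<Longrightarrow> 0 \<le> N x"
  by (simp add: N_def ip_nonneg)

lemma N_eq_0I: "x \<in> V \<Longrightarrow> N x \<le> 0 \<Longrightarrow> N x = 0"
  by (intro antisym N_nonneg)

lemma N_sq: "x \<in> V \<Longrightarrow> (N x)\<^sup>2 = ip x x"
  by (simp add: N_def ip_nonneg)

lemma N_scale: "x \<in> V \<Longrightarrow> N (c *\<^sub>R x) = \<bar>c\<bar> * N x"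
proof -
  assume "x \<in> V"
  then have "ip (c *\<^sub>R x) (c *\<^sub>R x) = c\<^sup>2 * ip x x" by (simp add: ip_simps power2_eq_square)
  then show ?thesis by (simp add: N_def real_sqrt_mult)
qed

lemma N_zero [simp]: "N 0 = 0"
  using N_scale[of 0 0] by simp

lemma N_minus: "x \<in> V \<Longrightarrow> N (- x) = N x"
  using N_scale[of x "-1"] by simp

lemma N_commute: "x \<in> V \<Longrightarrow> y \<in> V \<Longrightarrow> N (x - y) = N (y - x)"
  using N_minus[of "x - y"] by simp

lemma Cauchy_Schwarz: 
  assumes "x \<in> V" "y \<in> V" shows "\<bar>ip x y\<bar> \<le> N x * N y"
proof -
  have q: "0 \<le> t\<^sup>2 * ip x x - 2 * t * (s * ip x y) + s\<^sup>2 * ip y y" for s t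
    using ip_nonneg[of "t *\<^sub>R x - s *\<^sub>R y"] assms
    by (simp add: ip_simps ip_commute[of y x] power2_eq_square algebra_simps)
  have "(ip x y)\<^sup>2 \<le> ip x x * ip y y"
  proof (cases "ip x x = 0")
    case True
    have "ip x y = 0"
    proof (rule ccontr)
      assume "ip x y \<noteq> 0"
      then show False using q[of "(ip y y + 1) / (2 * ip x y)" 1] True by simp
    qed
    then show ?thesis using True by simp
  next
    case False
    then have p: "ip x x > 0" using ip_nonneg[OF assms(1)] by simp
    have "0 \<le> (ip x y)\<^sup>2 * ip x x - 2 * ip x y * (ip x x * ip x y) + (ip x x)\<^sup>2 * ip y y" by (rule q)
    also have "\<dots> = ip x x * (ip x x * ip y y - (ip x y)\<^sup>2)" 
      by (simp add: power2_eq_square algebra_simps)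
    finally show ?thesis using p by (simp add: zero_le_mult_iff)
  qed
  then have "sqrt ((ip x y)\<^sup>2) \<le> sqrt (ip x x * ip y y)" by (rule real_sqrt_le_mono)
  then show ?thesis by (simp add: N_def real_sqrt_mult)
qed

lemma N_triangle: assumes "x \<in> V" "y \<in> V" shows "N (x + y) \<le> N x + N y"
proof (rule power2_le_imp_le)
  have "(N (x + y))\<^sup>2 = (N x)\<^sup>2 + 2 * ip x y + (N y)\<^sup>2"
    using assms by (simp add: N_sq ip_simps ip_commute[of y x])
  also have "\<dots> \<le> (N x + N y)\<^sup>2"
    using Cauchy_Schwarz[OF assms] by (simp add: power2_sum)
  finally show "(N (x + y))\<^sup>2 \<le> (N x + N y)\<^sup>2" .
qed (use assms in simp)

lemma N_triangle_diff: "x \<in> V \<Longrightarrow> y \<in> V \<Longrightarrow> N (x - y) \<le> N x + N y"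
  using N_triangle[of x "- y"] N_minus by simp

lemma N_triangle3: "x \<in> V \<Longrightarrow> y \<in> V \<Longrightarrow> z \<in> V \<Longrightarrow> N (x - z) \<le> N (x - y) + N (y - z)"
  using N_triangle[of "x - y" "y - z"] by simp

lemma N_reverse_triangle: "x \<in> V \<Longrightarrow> y \<in> V \<Longrightarrow> \<bar>N x - N y\<bar> \<le> N (x - y)"
  using N_triangle[of "x - y" y] N_triangle[of "y - x" x] N_commute[of x y] by simp

lemma parallelogram: "x \<in> V \<Longrightarrow> y \<in> V \<Longrightarrow> (N (x + y))\<^sup>2 + (N (x - y))\<^sup>2 = 2 * (N x)\<^sup>2 + 2 * (N y)\<^sup>2"
  by (simp add: N_sq ip_simps)

lemma N_tendsto:
  assumes "\<And>n. s n \<in> V" "l \<in> V" "(\<lambda>n::nat. N (s n - l)) \<longlonglongrightarrow> 0"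
  shows "(\<lambda>n. N (s n)) \<longlonglongrightarrow> N l"
proof (rule LIM_zero_cancel, rule Lim_null_comparison[OF _ assms(3)])
  show "\<forall>\<^sub>F n in sequentially. norm (N (s n) - N l) \<le> N (s n - l)"
    using N_reverse_triangle assms by simp
qed

lemma ip_tendsto:
  assumes "\<And>n. s n \<in> V" "l \<in> V" "z \<in> V" "(\<lambda>n::nat. N (s n - l)) \<longlonglongrightarrow> 0"
  shows "(\<lambda>n. ip (s n) z) \<longlonglongrightarrow> ip l z"
proof (rule LIM_zero_cancel, rule Lim_null_comparison)
  show "\<forall>\<^sub>F n in sequentially. norm (ip (s n) z - ip l z) \<le> N (s n - l) * N z"
    using Cauchy_Schwarz[of "s n - l" z for n] assms by (simp add: ip_diff_left)
  show "(\<lambda>n. N (s n - l) * N z) \<longlonglongrightarrow> 0"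
    using tendsto_mult_right[OF assms(4), of "N z"] by simp
qed

end

locale semi_hilbert = semi_inner +
  assumes complete: "(\<And>n. s n \<in> V) \<Longrightarrow>
      (\<And>e. e > 0 \<Longrightarrow> \<exists>M::nat. \<forall>m\<ge>M. \<forall>n\<ge>M. N (s m - s n) < e) \<Longrightarrow>
      \<exists>l\<in>V. (\<lambda>n. N (s n - l)) \<longlonglongrightarrow> 0"
begin

text \<open>
  By the parallelogram law a sequence in \<open>S\<close> whose distances to \<open>x\<close> approach the infimum is Cauchy.
  Its limit \<open>p\<close> minimises the distance, and the first variation at \<open>p\<close> is the orthogonality relation.
\<close>

theorem projection:
  assumes S: "subspace S" "S \<subseteq> V"
    and closed: "\<And>s l. (\<And>n::nat. s n \<in> S) \<Longrightarrow> l \<in> V \<Longrightarrow> (\<lambda>n. N (s n - l)) \<longlonglongrightarrow> 0 \<Longrightarrow> l \<in> S"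
    and x: "x \<in> V"
  shows "\<exists>p\<in>S. \<forall>z\<in>S. ip (x - p) z = 0"
proof -
  define d where "d = (INF s\<in>S. (N (x - s))\<^sup>2)"
  have bdd: "bdd_below ((\<lambda>s. (N (x - s))\<^sup>2) ` S)" by (rule bdd_belowI2[of _ 0]) simp
  have d_le: "d \<le> (N (x - s))\<^sup>2" if "s \<in> S" for s
    unfolding d_def by (rule cINF_lower[OF bdd that])
  have "\<exists>s\<in>S. (N (x - s))\<^sup>2 < d + e" if "e > 0" for e
    using cINF_less_iff[OF _ bdd, of "d + e"] S subspace_0[of S] that unfolding d_def by fastforce
  then have "\<exists>s. \<forall>n. s n \<in> S \<and> (N (x - s n))\<^sup>2 < d + 1 / real (Suc n)"
    by (intro choice) (simp add: Bex_def[symmetric])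
  then obtain s where s: "\<And>n. s n \<in> S" "\<And>n. (N (x - s n))\<^sup>2 < d + 1 / real (Suc n)" by blast
  have sV [simp]: "s n \<in> V" for n using s S by blast
  have est: "(N (s m - s n))\<^sup>2 \<le> 2 / real (Suc m) + 2 / real (Suc n)" for m n
  proof -
    \<comment> \<open>The midpoint lies in the subspace, so its distance to the given vector is at least the infimum.\<close>
    define c where "c = (1/2) *\<^sub>R (s m + s n)"
    have c: "c \<in> S" unfolding c_def using s S by (auto intro: subspace_scale subspace_add)
    have "(x - s m) + (x - s n) = 2 *\<^sub>R (x - c)"
      by (simp add: c_def scaleR_diff_right scaleR_2 algebra_simps)
    then have "4 * (N (x - c))\<^sup>2 + (N ((x - s m) - (x - s n)))\<^sup>2
        = 2 * (N (x - s m))\<^sup>2 + 2 * (N (x - s n))\<^sup>2"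
      using parallelogram[of "x - s m" "x - s n"] N_scale[of "x - c" 2] x c S
      by (auto simp: power_mult_distrib)
    moreover have "N ((x - s m) - (x - s n)) = N (s m - s n)"
      using N_commute[of "s m" "s n"] by simp
    ultimately show ?thesis using d_le[OF c] s(2)[of m] s(2)[of n] by simp
  qed
  have "\<exists>l\<in>V. (\<lambda>n. N (s n - l)) \<longlonglongrightarrow> 0"
  proof (rule complete)
    fix e :: real assume e: "e > 0"
    obtain M where M: "1 / real (Suc M) < e\<^sup>2 / 4"
      using nat_approx_posE[of "e\<^sup>2 / 4"] e by auto
    have "N (s m - s n) < e" if "m \<ge> M" "n \<ge> M" for m n
    proof -
      have "1 / real (Suc m) \<le> 1 / real (Suc M)" "1 / real (Suc n) \<le> 1 / real (Suc M)"
        using that by (auto simp: frac_le)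
      then have "(N (s m - s n))\<^sup>2 < e\<^sup>2" using est[of m n] M by simp
      then show ?thesis using e by (simp add: power_less_imp_less_base)
    qed
    then show "\<exists>M. \<forall>m\<ge>M. \<forall>n\<ge>M. N (s m - s n) < e" by blast
  qed simp
  then obtain p where p: "p \<in> V" "(\<lambda>n. N (s n - p)) \<longlonglongrightarrow> 0" by blast
  have pS: "p \<in> S" using closed[OF s(1) p] .
  have "(\<lambda>n. N ((x - s n) - (x - p))) \<longlonglongrightarrow> 0"
    using p N_commute[of p "s n" for n] by simp
  then have "(\<lambda>n. N (x - s n)) \<longlonglongrightarrow> N (x - p)"
    using x p by (intro N_tendsto) auto
  then have "(\<lambda>n. (N (x - s n))\<^sup>2) \<longlonglongrightarrow> (N (x - p))\<^sup>2" by (rule tendsto_power)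
  moreover have "(\<lambda>n. d + 1 / real (Suc n)) \<longlonglongrightarrow> d"
    using tendsto_add[OF tendsto_const[of d] LIMSEQ_inverse_real_of_nat] by (simp add: field_simps)
  ultimately have pd: "(N (x - p))\<^sup>2 \<le> d"
    using s(2) by (intro LIMSEQ_le[where X="\<lambda>n. (N (x - s n))\<^sup>2"]) (auto intro: less_imp_le)
  have "ip (x - p) z = 0" if z: "z \<in> S" for z
  proof (rule nonneg_quadratic_imp_zero)
    have zV: "z \<in> V" using z S by blast
    then show "0 \<le> ip z z" by (rule ip_nonneg)
    fix t :: real
    have "p + t *\<^sub>R z \<in> S" using pS z S by (auto intro: subspace_add subspace_scale)
    then have "(N (x - p))\<^sup>2 \<le> (N ((x - p) - t *\<^sub>R z))\<^sup>2"
      using d_le pd by (fastforce simp: algebra_simps)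
    then have "ip (x - p) (x - p) \<le> ip ((x - p) - t *\<^sub>R z) ((x - p) - t *\<^sub>R z)"
      using x p zV by (simp add: N_sq)
    also have "\<dots> = ip (x - p) (x - p) + (t\<^sup>2 * ip z z - 2 * t * ip (x - p) z)"
    proof -
      have "ip (w - t *\<^sub>R z) (w - t *\<^sub>R z) = ip w w + (t\<^sup>2 * ip z z - 2 * t * ip w z)" if "w \<in> V" for w
        using that zV by (simp add: ip_simps ip_commute[of z w] power2_eq_square algebra_simps)
      then show ?thesis using x p by blast
    qed
    finally show "0 \<le> t\<^sup>2 * ip z z - 2 * t * ip (x - p) z" by simp
  qed
  then show ?thesis using pS by blast
qed

text \<open>
  Summing the geometric series bounds the distance between the first term and the limit, which is
  what makes the preimage in the open mapping theorem of controlled size.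
\<close>

lemma fast_Cauchy_converges:
  assumes V: "\<And>n. s n \<in> V" and B: "\<And>n. N (s (Suc n) - s n) \<le> c * (1/2)^n"
  shows "\<exists>l\<in>V. (\<lambda>n. N (s n - l)) \<longlonglongrightarrow> 0 \<and> N (s 0 - l) \<le> 2 * c"
proof -
  have "0 \<le> N (s (Suc 0) - s 0)" using V by simp
  then have c: "0 \<le> c" using B[of 0] by simp
  have step: "N (s (n + k) - s n) \<le> c * (2 * (1/2)^n - 2 * (1/2)^(n+k))" for n k
  proof (induction k)
    case (Suc k)
    have "N (s (n + Suc k) - s n) \<le> N (s (Suc (n + k)) - s (n + k)) + N (s (n + k) - s n)"
      using V by (simp add: N_triangle3)
    also have "\<dots> \<le> c * (1/2)^(n+k) + c * (2 * (1/2)^n - 2 * (1/2)^(n+k))"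
      using Suc B by (intro add_mono) auto
    also have "\<dots> = c * (2 * (1/2)^n - 2 * (1/2)^(n+Suc k))" by (simp add: algebra_simps)
    finally show ?case .
  qed simp
  have tail: "N (s m - s n) \<le> 2 * c * (1/2)^n" if "n \<le> m" for m n
  proof -
    have "N (s m - s n) \<le> c * (2 * (1/2)^n - 2 * (1/2)^m)"
      using step[of n "m - n"] that by simp
    also have "\<dots> \<le> c * (2 * (1/2)^n)" using c by (intro mult_left_mono) auto
    finally show ?thesis by simp
  qed
  have "\<exists>l\<in>V. (\<lambda>n. N (s n - l)) \<longlonglongrightarrow> 0"
  proof (rule complete)
    fix e :: real assume e: "e > 0"
    have "(\<lambda>n. 2 * c * (1/2)^n) \<longlonglongrightarrow> 2 * c * 0"
      by (intro tendsto_mult_left LIMSEQ_realpow_zero) auto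
    then obtain M where M: "2 * c * (1/2)^n < e" if "n \<ge> M" for n
      using order_tendstoD(2)[of _ "2 * c * 0" sequentially e] e
      by (auto simp: eventually_sequentially)
    have "N (s m - s n) < e" if "m \<ge> M" "n \<ge> M" for m n
    proof (cases "n \<le> m")
      case True then show ?thesis using tail[of n m] M[of n] that by simp
    next
      case False then show ?thesis
        using tail[of m n] M[of m] that N_commute[of "s m" "s n"] V by simp
    qed
    then show "\<exists>M. \<forall>m\<ge>M. \<forall>n\<ge>M. N (s m - s n) < e" by blast
  qed (rule V)
  then obtain l where l: "l \<in> V" "(\<lambda>n. N (s n - l)) \<longlonglongrightarrow> 0" by blast
  have "(\<lambda>n. N ((s 0 - s n) - (s 0 - l))) \<longlonglongrightarrow> 0"
    using l V N_commute[of l "s n" for n] by simp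
  then have "(\<lambda>n. N (s 0 - s n)) \<longlonglongrightarrow> N (s 0 - l)"
    using l V by (intro N_tendsto) auto
  moreover have "N (s 0 - s n) \<le> 2 * c" for n
    using tail[of 0 n] V N_commute[of "s 0" "s n"] by simp
  ultimately have "N (s 0 - l) \<le> 2 * c" by (intro LIMSEQ_le_const2) auto
  with l show ?thesis by blast
qed

section \<open>The open mapping theorem\<close>

text \<open>
  This is the form of Baire's theorem that the open mapping theorem uses: some \<open>A n\<close> is dense in a
  ball. Otherwise closed balls can be nested so that the next one avoids \<open>A n\<close>, and their common
  point lies in no \<open>A n\<close>.
\<close>

lemma Baire_dense_in_ball:
  fixes A :: "nat \<Rightarrow> 'a set"
  assumes cover: "V \<subseteq> (\<Union>n. A n)"
  shows "\<exists>n. \<exists>y\<in>V. \<exists>r>0. \<forall>z\<in>V. N (z - y) \<le> r \<longrightarrow> (\<forall>e>0. \<exists>a\<in>A n \<inter> V. N (a - z) < e)"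
proof (rule ccontr)
  assume contr: "\<not> ?thesis"
  have avoid: "\<exists>z\<in>V. \<exists>e>0. N (z - y) \<le> r \<and> (\<forall>a\<in>A n \<inter> V. e \<le> N (a - z))"
    if "y \<in> V" "r > 0" for n y r
    using contr that by (metis not_less)
  \<comment> \<open>A pair consists of the centre and the radius of a closed ball.\<close>
  define P where "P n b \<longleftrightarrow> fst b \<in> V \<and> 0 < snd b \<and> snd b \<le> (1/2)^n" for n and b :: "'a \<times> real"
  define Q where "Q n b b' \<longleftrightarrow> N (fst b' - fst b) + snd b' \<le> snd b \<and> (\<forall>a\<in>A n \<inter> V. snd b' < N (a - fst b'))"
    for n and b b' :: "'a \<times> real"
  have "\<exists>f. \<forall>n. P n (f n) \<and> Q n (f n) (f (Suc n))"
  proof (rule dependent_nat_choice)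
    show "\<exists>b. P 0 b" by (rule exI[of _ "(0, 1)"]) (simp add: P_def)
    fix b n assume b: "P n b"
    then obtain z e where z: "z \<in> V" "e > 0" "N (z - fst b) \<le> snd b / 2"
      "\<And>a. a \<in> A n \<inter> V \<Longrightarrow> e \<le> N (a - z)"
      using avoid[of "fst b" "snd b / 2" n] by (auto simp: P_def)
    define r where "r = min (e / 2) (snd b / 2)"
    have "P (Suc n) (z, r)" "Q n b (z, r)"
      using b z by (fastforce simp: P_def Q_def r_def min_def)+
    then show "\<exists>b'. P (Suc n) b' \<and> Q n b b'" by blast
  qed
  then obtain f where P: "\<And>n. P n (f n)" and Q: "\<And>n. Q n (f n) (f (Suc n))" by blast
  define c where "c n = fst (f n)" for n
  define r where "r n = snd (f n)" for n
  have cV: "c n \<in> V" and r: "0 < r n" "r n \<le> (1/2)^n" for n using P[of n] by (auto simp: P_def c_def r_def)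
  have nest: "N (c (Suc n) - c n) + r (Suc n) \<le> r n" for n using Q[of n] by (simp add: Q_def c_def r_def)
  have "\<exists>l\<in>V. (\<lambda>n. N (c n - l)) \<longlonglongrightarrow> 0 \<and> N (c 0 - l) \<le> 2 * 1"
    using nest r cV by (intro fast_Cauchy_converges) (smt (verit))+
  then obtain l where l: "l \<in> V" "(\<lambda>n. N (c n - l)) \<longlonglongrightarrow> 0" by blast
  have in_ball: "N (c (n + k) - c n) + r (n + k) \<le> r n" for n k
  proof (induction k)
    case (Suc k)
    then show ?case
      using nest[of "n + k"] N_triangle3[of "c (Suc (n + k))" "c (n + k)" "c n"] cV by simp
  qed simp
  have l_ball: "N (l - c n) \<le> r n" for n
  proof (rule LIMSEQ_le_const2)
    have "(\<lambda>k. N (c (k + n) - l)) \<longlonglongrightarrow> 0" using l(2) by (rule LIMSEQ_ignore_initial_segment)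
    then have "(\<lambda>k. N ((c (k + n) - c n) - (l - c n))) \<longlonglongrightarrow> 0" by simp
    then show "(\<lambda>k. N (c (k + n) - c n)) \<longlonglongrightarrow> N (l - c n)"
      using cV l by (intro N_tendsto) auto
    show "\<exists>M. \<forall>k\<ge>M. N (c (k + n) - c n) \<le> r n"
      using in_ball[of n k for k] r(1) by (metis add.commute less_imp_le order_trans le_add_same_cancel1)
  qed
  obtain n where "l \<in> A n" using l cover by blast
  then have "r (Suc n) < N (l - c (Suc n))" using Q[of n] l by (auto simp: Q_def c_def r_def)
  with l_ball[of "Suc n"] show False by simp
qed

end

text \<open>
  Linearity holds only up to vectors of norm zero, as for operators acting on representatives of
  classes of functions.
\<close>

locale semi_linear_operator =
  X: semi_hilbert V ipV + Y: semi_hilbert W ipW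
  for V :: "'v::real_vector set" and ipV and W :: "'w::real_vector set" and ipW +
  fixes T :: "'v \<Rightarrow> 'w" and K :: real
  assumes T_in: "x \<in> V \<Longrightarrow> T x \<in> W"
    and T_lin: "x \<in> V \<Longrightarrow> y \<in> V \<Longrightarrow> Y.N (T (a *\<^sub>R x + b *\<^sub>R y) - (a *\<^sub>R T x + b *\<^sub>R T y)) = 0"
    and T_bound: "x \<in> V \<Longrightarrow> Y.N (T x) \<le> K * X.N x"
begin

text \<open>
  The zero vector serves as preimage of every vector of norm zero. These have to be treated apart
  because they cannot be rescaled to a given norm.
\<close>

lemma T_null: assumes "z \<in> W" "Y.N z = 0" shows "Y.N (T 0 - z) = 0"
proof -
  have T0: "T 0 \<in> W" by (simp add: T_in)
  have "Y.N (T 0 - z) \<le> Y.N (T 0) + Y.N z" using T0 assms by (intro Y.N_triangle_diff)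
  also have "\<dots> \<le> 0" using T_bound[of 0] assms by simp
  finally show ?thesis using T0 assms by (intro antisym Y.N_nonneg) auto
qed

text \<open>
  Baire's theorem, applied to the images of the balls of radius \<open>n\<close>, makes one of them dense in a ball.
  By translation and scaling, every \<open>z\<close> is approximated arbitrarily well by images of vectors of norm
  at most \<open>M \<parallel>z\<parallel>\<close>. Correcting the remaining error again and again, each time halving it, gives a
  series whose sum is an exact preimage of norm at most \<open>2 M \<parallel>y\<parallel>\<close>.
\<close>

theorem open_mapping:
  assumes surj: "\<And>y. y \<in> W \<Longrightarrow> \<exists>x\<in>V. Y.N (T x - y) = 0"
  shows "\<exists>c. \<forall>y\<in>W. \<exists>x\<in>V. Y.N (T x - y) = 0 \<and> X.N x \<le> c * Y.N y"
proof -
  define A where "A n = {y\<in>W. \<exists>x\<in>V. Y.N (T x - y) = 0 \<and> X.N x \<le> real n}" for n :: nat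
  have "W \<subseteq> (\<Union>n. A n)"
  proof
    fix y assume y: "y \<in> W"
    then obtain x where "x \<in> V" "Y.N (T x - y) = 0" using surj by blast
    moreover obtain n where "X.N x \<le> real n" using real_arch_simple by blast
    ultimately show "y \<in> (\<Union>n. A n)" using y by (auto simp: A_def)
  qed
  from Y.Baire_dense_in_ball[OF this] obtain n y0 r where y0: "y0 \<in> W" "r > 0"
    and dense: "\<And>z e. z \<in> W \<Longrightarrow> Y.N (z - y0) \<le> r \<Longrightarrow> e > 0 \<Longrightarrow> \<exists>a\<in>A n \<inter> W. Y.N (a - z) < e"
    by blast
  have preimage: "\<exists>x\<in>V. X.N x \<le> real n \<and> Y.N (T x - z) < e" 
    if z: "z \<in> W" "Y.N (z - y0) \<le> r" "e > 0" for z e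
  proof -
    obtain a where a: "a \<in> A n" "a \<in> W" "Y.N (a - z) < e" using dense[OF z] by blast
    then obtain x where x: "x \<in> V" "Y.N (T x - a) = 0" "X.N x \<le> real n" by (auto simp: A_def)
    then have "Y.N (T x - z) < e" using Y.N_triangle3[of "T x" a z] a z T_in by simp
    with x show ?thesis by blast
  qed
  define M where "M = 2 * real n / r"
  have M: "0 \<le> M" using y0 by (simp add: M_def)
  have approx: "\<exists>x\<in>V. X.N x \<le> M * Y.N z \<and> Y.N (T x - z) < e" if z: "z \<in> W" and e: "e > 0" for z e
  proof (cases "Y.N z = 0")
    case True
    have "Y.N (T 0 - z) = 0" using T_null z True .
    then show ?thesis using True e by (intro bexI[of _ 0]) auto
  next
    case False
    then have p: "Y.N z > 0" using Y.N_nonneg[OF z] by simp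
    \<comment> \<open>Scaling to length \<open>r\<close> makes both \<open>y0\<close> and \<open>y0 + t z\<close> lie in the ball where the image is dense.\<close>
    define t where "t = r / Y.N z"
    have t: "t > 0" using p y0 by (simp add: t_def)
    have tz: "Y.N (t *\<^sub>R z) = r" using z t p y0 by (simp add: Y.N_scale t_def)
    obtain x1 where x1: "x1 \<in> V" "X.N x1 \<le> real n" "Y.N (T x1 - (y0 + t *\<^sub>R z)) < e * t / 2"
      using preimage[of "y0 + t *\<^sub>R z" "e * t / 2"] y0 z tz e t by auto
    obtain x2 where x2: "x2 \<in> V" "X.N x2 \<le> real n" "Y.N (T x2 - y0) < e * t / 2"
      using preimage[of y0 "e * t / 2"] y0 e t by auto
    define x where "x = (1/t) *\<^sub>R x1 + (- 1/t) *\<^sub>R x2"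
    have x: "x \<in> V" unfolding x_def using x1 x2 by blast
    have "x = (1/t) *\<^sub>R (x1 - x2)" by (simp add: x_def scaleR_diff_right)
    then have "X.N x = (1/t) * X.N (x1 - x2)" using x1 x2 t by (simp add: X.N_scale)
    also have "\<dots> \<le> (1/t) * (2 * real n)"
      using X.N_triangle_diff[of x1 x2] x1 x2 t by (intro mult_left_mono) auto
    also have "\<dots> = M * Y.N z" using p y0 by (simp add: M_def t_def)
    finally have nx: "X.N x \<le> M * Y.N z" .
    have W: "T x \<in> W" "T x1 \<in> W" "T x2 \<in> W" using T_in x x1 x2 by auto
    have "Y.N (T x - z) \<le> Y.N (T x - ((1/t) *\<^sub>R T x1 + (- 1/t) *\<^sub>R T x2))
          + Y.N (((1/t) *\<^sub>R T x1 + (- 1/t) *\<^sub>R T x2) - z)"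
      using W z by (intro Y.N_triangle3) auto
    also have "\<dots> = Y.N (((1/t) *\<^sub>R T x1 + (- 1/t) *\<^sub>R T x2) - z)"
      using T_lin[of x1 x2 "1/t" "-1/t"] x1 x2 by (simp add: x_def)
    also have "((1/t) *\<^sub>R T x1 + (- 1/t) *\<^sub>R T x2) - z
        = (1/t) *\<^sub>R ((T x1 - (y0 + t *\<^sub>R z)) - (T x2 - y0))"
      using t by (simp add: algebra_simps)
    also have "Y.N \<dots> = (1/t) * Y.N ((T x1 - (y0 + t *\<^sub>R z)) - (T x2 - y0))"
      using W y0 z t by (subst Y.N_scale) auto
    also have "\<dots> \<le> (1/t) * (Y.N (T x1 - (y0 + t *\<^sub>R z)) + Y.N (T x2 - y0))"
      using W y0 z t by (intro mult_left_mono Y.N_triangle_diff) auto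
    also have "\<dots> < (1/t) * (e * t)"
      using x1 x2 t by (intro mult_strict_left_mono) auto
    also have "\<dots> = e" using t by simp
    finally show ?thesis using nx x by blast
  qed
  have "\<exists>x\<in>V. Y.N (T x - y) = 0 \<and> X.N x \<le> 2 * M * Y.N y" if y: "y \<in> W" for y
  proof (cases "Y.N y = 0")
    case True
    then show ?thesis using T_null[OF y] by (intro bexI[of _ 0]) auto
  next
    case False
    then have p: "Y.N y > 0" using Y.N_nonneg[OF y] by simp
    \<comment> \<open>The partial sums start at zero and leave an error of at most \<open>\<parallel>y\<parallel> / 2^k\<close>.\<close>
    define P where "P k s \<longleftrightarrow> s \<in> V \<and> Y.N (y - T s) \<le> Y.N y * (1/2)^k \<and> (k = 0 \<longrightarrow> s = 0)" for k :: nat and s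
    define Q where "Q k s s' \<longleftrightarrow> X.N (s' - s) \<le> M * Y.N y * (1/2)^k" for k :: nat and s s'
    have "\<exists>s. \<forall>k. P k (s k) \<and> Q k (s k) (s (Suc k))"
    proof (rule dependent_nat_choice)
      have "Y.N (y - T 0) \<le> Y.N y" using Y.N_triangle_diff[of y "T 0"] T_in[of 0] y T_null[of 0] by simp
      then show "\<exists>s. P 0 s" by (auto simp: P_def)
      fix s k assume s: "P k s"
      then have sV: "s \<in> V" and sN: "Y.N (y - T s) \<le> Y.N y * (1/2)^k" by (auto simp: P_def)
      have Ts: "T s \<in> W" using T_in sV .
      obtain x where x: "x \<in> V" "X.N x \<le> M * Y.N (y - T s)"
          "Y.N (T x - (y - T s)) < Y.N y * (1/2)^(Suc k)"
        using approx[of "y - T s" "Y.N y * (1/2)^(Suc k)"] y Ts p by auto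
      define s' where "s' = 1 *\<^sub>R s + 1 *\<^sub>R x"
      have s': "s' \<in> V" "T s' \<in> W" "T x \<in> W" unfolding s'_def using sV x by (auto intro: T_in)
      have "Y.N (y - T s') \<le> Y.N (y - (1 *\<^sub>R T s + 1 *\<^sub>R T x)) + Y.N ((1 *\<^sub>R T s + 1 *\<^sub>R T x) - T s')"
        using s' Ts y by (intro Y.N_triangle3) auto
      also have "Y.N ((1 *\<^sub>R T s + 1 *\<^sub>R T x) - T s') = Y.N (T s' - (1 *\<^sub>R T s + 1 *\<^sub>R T x))"
        using s' Ts by (intro Y.N_commute) auto
      also have "\<dots> = 0" unfolding s'_def using sV x by (intro T_lin)
      also have "Y.N (y - (1 *\<^sub>R T s + 1 *\<^sub>R T x)) = Y.N (T x - (y - T s))"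
        using Y.N_commute[of "T x" "y - T s"] s' Ts y by (simp add: algebra_simps)
      finally have "Y.N (y - T s') \<le> Y.N y * (1/2)^(Suc k)" using x by simp
      moreover have "X.N (s' - s) \<le> M * Y.N y * (1/2)^k"
        using x(2) mult_left_mono[OF sN M] by (simp add: s'_def mult.assoc)
      ultimately show "\<exists>s'. P (Suc k) s' \<and> Q k s s'"
        using s' unfolding P_def Q_def by blast
    qed
    then obtain s where P: "\<And>k. P k (s k)" and Q: "\<And>k. Q k (s k) (s (Suc k))" by blast
    have sV: "s k \<in> V" for k using P by (auto simp: P_def)
    have s0: "s 0 = 0" using P[of 0] by (simp add: P_def)
    obtain x where x: "x \<in> V" "(\<lambda>k. X.N (s k - x)) \<longlonglongrightarrow> 0" "X.N (s 0 - x) \<le> 2 * (M * Y.N y)"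
      using X.fast_Cauchy_converges[of s "M * Y.N y"] sV Q by (auto simp: Q_def)
    have TW: "T x \<in> W" "T (s k) \<in> W" for k using T_in x sV by auto
    have "Y.N (T x - y) \<le> K * X.N (s k - x) + Y.N y * (1/2)^k" for k
    proof -
      have a: "T (s k - x) \<in> W" using sV x by (intro T_in) auto
      have "Y.N (T (s k) - T x) \<le> Y.N ((T (s k) - T x) - T (s k - x)) + Y.N (T (s k - x))"
        using Y.N_triangle[of "(T (s k) - T x) - T (s k - x)" "T (s k - x)"] a TW by auto
      also have "Y.N ((T (s k) - T x) - T (s k - x)) = Y.N (T (s k - x) - (T (s k) - T x))"
        using a TW by (intro Y.N_commute) auto
      also have "\<dots> = 0" using T_lin[of "s k" x 1 "-1"] sV x by simp
      also have "Y.N (T (s k - x)) \<le> K * X.N (s k - x)" using sV x by (intro T_bound) auto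
      finally have 1: "Y.N (T x - T (s k)) \<le> K * X.N (s k - x)" 
        using Y.N_commute[of "T x" "T (s k)"] TW by simp
      have "Y.N (T (s k) - y) \<le> Y.N y * (1/2)^k"
        using P[of k] Y.N_commute[of y "T (s k)"] y TW by (simp add: P_def)
      with 1 Y.N_triangle3[of "T x" "T (s k)" y] TW y show ?thesis by fastforce
    qed
    moreover have "(\<lambda>k. K * X.N (s k - x) + Y.N y * (1/2)^k) \<longlonglongrightarrow> K * 0 + Y.N y * 0"
      by (intro tendsto_intros x LIMSEQ_realpow_zero) auto
    ultimately have "Y.N (T x - y) \<le> K * 0 + Y.N y * 0"
      by (intro LIMSEQ_le_const) auto
    then have "Y.N (T x - y) = 0" using TW y by (intro Y.N_eq_0I) auto
    moreover have "X.N x \<le> 2 * M * Y.N y" using x(3) s0 x(1) by (simp add: X.N_minus)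
    ultimately show ?thesis using x(1) by blast
  qed
  then show ?thesis by blast
qed

end


section \<open>Completeness of the space of square integrable functions\<close>

lemma mem_L2: "f \<in> carr (L2 M) \<longleftrightarrow> f \<in> borel_measurable M \<and> integrable M (\<lambda>x. (norm (f x))\<^sup>2)"
  for f :: "'a \<Rightarrow> 'b::euclidean_space"
  by (simp add: L2_def)

lemma L2_measurable: "f \<in> carr (L2 M) \<Longrightarrow> f \<in> borel_measurable M"
  by (simp add: mem_L2)

lemma ip_L2: "ip (L2 M) f g = (\<integral>x. f x \<bullet> g x \<partial>M)"
  by (simp add: L2_def)

lemma base_L2: "base (L2 M) = M"
  by (simp add: L2_def)

lemma L2_integrable_inner:
  assumes "f \<in> carr (L2 M)" "g \<in> carr (L2 M)"
  shows "integrable M (\<lambda>x. f x \<bullet> g x)"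
proof (rule Bochner_Integration.integrable_bound)
  show "integrable M (\<lambda>x. (norm (f x))\<^sup>2 + (norm (g x))\<^sup>2)"
    using assms by (auto simp: mem_L2)
  show "(\<lambda>x. f x \<bullet> g x) \<in> borel_measurable M"
    using assms by (auto simp: mem_L2)
  have "\<bar>a \<bullet> b\<bar> \<le> (norm a)\<^sup>2 + (norm b)\<^sup>2" for a b :: 'b
    using Cauchy_Schwarz_ineq2[of a b] sum_squares_bound[of "norm a" "norm b"] mult_nonneg_nonneg[of "norm a" "norm b"]
    by simp
  then show "AE x in M. norm (f x \<bullet> g x) \<le> norm ((norm (f x))\<^sup>2 + (norm (g x))\<^sup>2)"
    by simp
qed

lemma L2_semi_inner: "semi_inner (carr (L2 M)) (ip (L2 M :: ('a, 'b::euclidean_space) ip_space))"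
proof
  show "subspace (carr (L2 M :: ('a, 'b) ip_space))"
  proof (rule subspaceI)
    show "0 \<in> carr (L2 M :: ('a, 'b) ip_space)" by (simp add: mem_L2 zero_fun_def)
    fix f g :: "'a \<Rightarrow> 'b" assume fg: "f \<in> carr (L2 M)" "g \<in> carr (L2 M)"
    have "integrable M (\<lambda>x. (norm (f x))\<^sup>2 + 2 * (f x \<bullet> g x) + (norm (g x))\<^sup>2)"
      using fg L2_integrable_inner[OF fg] by (auto simp: mem_L2)
    also have "(\<lambda>x. (norm (f x))\<^sup>2 + 2 * (f x \<bullet> g x) + (norm (g x))\<^sup>2) = (\<lambda>x. (norm ((f + g) x))\<^sup>2)"
      by (auto simp: power2_norm_eq_inner inner_add_left inner_add_right inner_commute)
    finally show "f + g \<in> carr (L2 M)"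
      using fg by (auto simp: mem_L2 plus_fun_def)
  next
    fix f :: "'a \<Rightarrow> 'b" and c assume f: "f \<in> carr (L2 M)"
    then show "c *\<^sub>R f \<in> carr (L2 M)"
      by (auto simp: mem_L2 scaleR_fun_def power_mult_distrib)
  qed
  fix f g h :: "'a \<Rightarrow> 'b" and c
  assume f: "f \<in> carr (L2 M)"
  then show "0 \<le> ip (L2 M) f f" by (simp add: ip_L2)
  assume h: "h \<in> carr (L2 M)"
  show "ip (L2 M) f h = ip (L2 M) h f" by (simp add: ip_L2 inner_commute)
  show "ip (L2 M) (c *\<^sub>R f) h = c * ip (L2 M) f h" by (simp add: ip_L2)
  assume "g \<in> carr (L2 M)"
  with f h show "ip (L2 M) (f + g) h = ip (L2 M) f h + ip (L2 M) g h"
    by (simp add: ip_L2 inner_add_left L2_integrable_inner)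
qed

lemma nrm_eq_N: "nrm X = semi_inner.N (ip X)" if "semi_inner V (ip X)"
  using that by (simp add: fun_eq_iff nrm_def semi_inner.N_def)

interpretation L2: semi_inner "carr (L2 M)" "ip (L2 M :: ('a, 'b::euclidean_space) ip_space)"
  rewrites "semi_inner.N (ip (L2 M)) = nrm (L2 M)"
  for M :: "'a measure"
  by (rule L2_semi_inner, simp add: nrm_eq_N[OF L2_semi_inner])

lemma nn_integral_L2:
  assumes "f \<in> carr (L2 M)"
  shows "(\<integral>\<^sup>+x. ennreal ((norm (f x))\<^sup>2) \<partial>M) = ennreal ((nrm (L2 M) f)\<^sup>2)"
  using assms L2.N_sq[OF assms]
  by (subst nn_integral_eq_integral) (auto simp: mem_L2 ip_L2 power2_norm_eq_inner)

text \<open>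
  Membership and the bound on the norm come together, in the shape in which Fatou's lemma delivers
  them.
\<close>

lemma L2_I_nn_integral:
  fixes f :: "'a \<Rightarrow> 'b::euclidean_space"
  assumes "f \<in> borel_measurable M" "(\<integral>\<^sup>+x. ennreal ((norm (f x))\<^sup>2) \<partial>M) \<le> ennreal (e\<^sup>2)" "0 \<le> e"
  shows "f \<in> carr (L2 M)" "nrm (L2 M) f \<le> e"
proof -
  have "integrable M (\<lambda>x. (norm (f x))\<^sup>2)"
    using assms le_less_trans[OF assms(2) ennreal_less_top]
    by (intro integrableI_nonneg) auto
  with assms show 1: "f \<in> carr (L2 M)" by (simp add: mem_L2)
  have "(nrm (L2 M) f)\<^sup>2 \<le> e\<^sup>2" using assms(2) nn_integral_L2[OF 1] by simp
  then show "nrm (L2 M) f \<le> e" using assms(3) power2_le_imp_le by blast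
qed

lemma L2_null_iff:
  assumes "f \<in> carr (L2 M)"
  shows "nrm (L2 M) f = 0 \<longleftrightarrow> (AE x in M. f x = 0)"
proof -
  have "nrm (L2 M) f = 0 \<longleftrightarrow> (\<integral>\<^sup>+x. ennreal ((norm (f x))\<^sup>2) \<partial>M) = 0"
    using nn_integral_L2[OF assms] L2.N_nonneg[OF assms] by simp
  also have "\<dots> \<longleftrightarrow> (AE x in M. f x = 0)"
    using L2_measurable[OF assms] by (subst nn_integral_0_iff_AE) auto
  finally show ?thesis .
qed

lemma L2_cong_AE:
  fixes f g :: "'a \<Rightarrow> 'b::euclidean_space"
  assumes "AE x in M. f x = g x" "f \<in> carr (L2 M)" "g \<in> carr (L2 M)" "h \<in> carr (L2 M)"
  shows "ip (L2 M) f h = ip (L2 M) g h"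
proof -
  have [measurable]: "f \<in> borel_measurable M" "g \<in> borel_measurable M" "h \<in> borel_measurable M"
    using assms by (auto simp: mem_L2)
  show ?thesis unfolding ip_L2 using assms(1) by (intro integral_cong_AE) auto
qed

text \<open>
  With \<open>c = 2^k\<close> this reduces summability of \<open>norm (d k)\<close> to that of \<open>2^k (norm (d k))\<^sup>2\<close>, which can be
  integrated.
\<close>

lemma norm_le_weighted: "norm a \<le> c * (norm a)\<^sup>2 + 1 / c" if "c > 0" for c :: real
proof -
  have "2 * (c * norm a) \<le> (c * norm a)\<^sup>2 + 1"
    using sum_squares_bound[of "c * norm a" 1] by simp
  also have "\<dots> = c * (c * (norm a)\<^sup>2 + 1 / c)"
    using that by (simp add: power2_eq_square algebra_simps)
  finally have "c * (2 * norm a) \<le> c * (c * (norm a)\<^sup>2 + 1 / c)" by simp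
  then have "2 * norm a \<le> c * (norm a)\<^sup>2 + 1 / c" using that by (simp only: mult_le_cancel_left_pos)
  then show ?thesis using norm_ge_zero[of a] by linarith
qed

text \<open>
  Along a subsequence the increments have norm at most \<open>2^-k\<close>, so the weighted sum of their squares is
  integrable, hence finite almost everywhere, and the subsequence converges pointwise almost
  everywhere. Fatou's lemma shows that the pointwise limit is also the limit in norm.
\<close>

lemma L2_complete:
  fixes s :: "nat \<Rightarrow> 'a \<Rightarrow> 'b::euclidean_space"
  assumes s: "\<And>n. s n \<in> carr (L2 M)"
    and Cauchy: "\<And>e. e > 0 \<Longrightarrow> \<exists>K::nat. \<forall>m\<ge>K. \<forall>n\<ge>K. nrm (L2 M) (s m - s n) < e"
  shows "\<exists>l\<in>carr (L2 M). (\<lambda>n. nrm (L2 M) (s n - l)) \<longlonglongrightarrow> 0"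
proof -
  have [measurable]: "s n \<in> borel_measurable M" for n using s by (rule L2_measurable)
  have "\<forall>k. \<exists>K::nat. \<forall>m\<ge>K. \<forall>n\<ge>K. nrm (L2 M) (s m - s n) < (1/2)^k"
    using Cauchy by simp
  then obtain K :: "nat \<Rightarrow> nat" where K: "\<And>k m n. m \<ge> K k \<Longrightarrow> n \<ge> K k \<Longrightarrow> nrm (L2 M) (s m - s n) < (1/2)^k"
    by metis
  define r where "r k = k + (\<Sum>i\<le>k. K i)" for k
  have r: "K k \<le> r k" "r k \<le> r (Suc k)" "k \<le> r k" for k
    using member_le_sum[of k "{..k}" K] by (auto simp: r_def)
  define d where "d k = s (r (Suc k)) - s (r k)" for k
  have d: "d k \<in> carr (L2 M)" for k unfolding d_def using s by (intro L2.V_diff)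
  have [measurable]: "d k \<in> borel_measurable M" for k using d by (rule L2_measurable)
  have nd: "nrm (L2 M) (d k) \<le> (1/2)^k" for k
    unfolding d_def using r[of k] K[of k "r (Suc k)" "r k"] by simp
  have "(\<integral>\<^sup>+x. (\<Sum>k. ennreal (2^k * (norm (d k x))\<^sup>2)) \<partial>M) = (\<Sum>k. \<integral>\<^sup>+x. ennreal (2^k * (norm (d k x))\<^sup>2) \<partial>M)"
    by (rule nn_integral_suminf) simp
  also have "\<dots> = (\<Sum>k. ennreal (2^k * (nrm (L2 M) (d k))\<^sup>2))"
    by (simp add: ennreal_mult nn_integral_cmult nn_integral_L2[OF d])
  also have "\<dots> \<le> (\<Sum>k. ennreal ((1/2)^k))"
  proof (intro suminf_le summableI ennreal_leI)
    fix k
    have "2^k * (nrm (L2 M) (d k))\<^sup>2 \<le> 2^k * ((1/2)^k)\<^sup>2"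
      using nd[of k] d by (intro mult_left_mono power_mono) auto
    also have "\<dots> = (1/2)^k" by (simp add: power2_eq_square power_divide)
    finally show "2^k * (nrm (L2 M) (d k))\<^sup>2 \<le> (1/2)^k" .
  qed
  also have "\<dots> < \<infinity>" by (subst suminf_ennreal2) (auto intro: summable_geometric)
  finally have "(\<integral>\<^sup>+x. (\<Sum>k. ennreal (2^k * (norm (d k x))\<^sup>2)) \<partial>M) \<noteq> \<infinity>" by simp
  then have "AE x in M. (\<Sum>k. ennreal (2^k * (norm (d k x))\<^sup>2)) \<noteq> \<infinity>"
    by (intro nn_integral_PInf_AE) auto
  then have conv: "AE x in M. convergent (\<lambda>k. s (r k) x)"
  proof eventually_elim
    case (elim x)
    then have "summable (\<lambda>k. 2^k * (norm (d k x))\<^sup>2)"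
      by (intro summable_suminf_not_top) auto
    then have "summable (\<lambda>k. 2^k * (norm (d k x))\<^sup>2 + (1/2)^k)"
      by (intro summable_add summable_geometric) auto
    then have "summable (\<lambda>k. d k x)"
    proof (rule summable_comparison_test')
      show "norm (d k x) \<le> 2^k * (norm (d k x))\<^sup>2 + (1/2)^k" for k
        using norm_le_weighted[of "2^k" "d k x"] by (simp add: power_divide)
    qed
    then have "convergent (\<lambda>k. s (r 0) x + (\<Sum>i<k. d i x))"
      by (intro convergent_add convergent_const) (simp add: summable_iff_convergent)
    then show ?case by (simp add: d_def sum_lessThan_telescope[of "\<lambda>i. s (r i) x"])
  qed
  define l where "l x = lim (\<lambda>k. s (r k) x)" for x
  have l_meas [measurable]: "l \<in> borel_measurable M" unfolding l_def by measurable
  have lim: "AE x in M. (\<lambda>k. s (r k) x) \<longlonglongrightarrow> l x"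
    using conv by eventually_elim (simp add: l_def convergent_LIMSEQ_iff)
  have close: "s n - l \<in> carr (L2 M) \<and> nrm (L2 M) (s n - l) \<le> (1/2)^k" if n: "n \<ge> K k" for n k
  proof -
    have "(\<integral>\<^sup>+x. ennreal ((norm ((s n - l) x))\<^sup>2) \<partial>M)
        = (\<integral>\<^sup>+x. liminf (\<lambda>j. ennreal ((norm ((s n - s (r j)) x))\<^sup>2)) \<partial>M)"
    proof (rule nn_integral_cong_AE, use lim in eventually_elim)
      case (elim x)
      then have "(\<lambda>j. ennreal ((norm ((s n - s (r j)) x))\<^sup>2)) \<longlonglongrightarrow> ennreal ((norm ((s n - l) x))\<^sup>2)"
        by (auto intro!: tendsto_intros)
      then show ?case using lim_imp_Liminf[OF sequentially_bot] by metis
    qed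
    also have "\<dots> \<le> liminf (\<lambda>j. \<integral>\<^sup>+x. ennreal ((norm ((s n - s (r j)) x))\<^sup>2) \<partial>M)"
      by (rule nn_integral_liminf) simp
    also have "\<dots> = liminf (\<lambda>j. ennreal ((nrm (L2 M) (s n - s (r j)))\<^sup>2))"
      using s by (subst nn_integral_L2) auto
    also have "\<dots> \<le> liminf (\<lambda>j::nat. ennreal (((1/2)^k)\<^sup>2))"
    proof (rule Liminf_mono, rule eventually_sequentiallyI[of "K k"])
      fix j assume "K k \<le> j"
      then have "K k \<le> r j" using r(3)[of j] by simp
      then show "ennreal ((nrm (L2 M) (s n - s (r j)))\<^sup>2) \<le> ennreal (((1/2)^k)\<^sup>2)"
        using K[OF n, of "r j"] s by (intro ennreal_leI power_mono) auto
    qed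
    also have "\<dots> = ennreal (((1/2)^k)\<^sup>2)" by (intro lim_imp_Liminf) auto
    finally show ?thesis
      using L2_I_nn_integral[of "s n - l" M "(1/2)^k"] by (auto simp: fun_diff_def)
  qed
  have "s (K 0) - (s (K 0) - l) \<in> carr (L2 M)"
    using s close[OF order_refl, of 0] by (blast intro: L2.V_diff)
  also have "s (K 0) - (s (K 0) - l) = l" by (simp add: fun_eq_iff)
  finally have l: "l \<in> carr (L2 M)" .
  have "(\<lambda>n. nrm (L2 M) (s n - l)) \<longlonglongrightarrow> 0"
  proof (rule LIMSEQ_I)
    fix e :: real assume "e > 0"
    then obtain k where k: "(1/2)^k < e" using real_arch_pow_inv[of e "1/2"] by auto
    have "norm (nrm (L2 M) (s n - l) - 0) < e" if "n \<ge> K k" for n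
      using close[OF that] k L2.N_nonneg[of "s n - l" M] by auto
    then show "\<exists>K. \<forall>n\<ge>K. norm (nrm (L2 M) (s n - l) - 0) < e" by blast
  qed
  with l show ?thesis by blast
qed


section \<open>Test functions\<close>

text \<open>
  The negative powers of \<open>t\<close> are included so that the family is closed under differentiation up to
  linear combinations. All members vanish to infinite order at \<open>0\<close>.
\<close>

definition flat_exp :: "nat \<Rightarrow> real \<Rightarrow> real" where
  "flat_exp m t = (if 0 < t then exp (- 1 / t) / t ^ m else 0)"

lemma flat_exp_over_t_tendsto_0: "((\<lambda>t. flat_exp m t / t) \<longlongrightarrow> 0) (at 0)"
proof (rule filterlim_split_at)
  have "((\<lambda>t::real. inverse t ^ Suc m / exp (inverse t)) \<longlongrightarrow> 0) (at_right 0)"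
    by (rule filterlim_compose[OF tendsto_power_div_exp_0 filterlim_inverse_at_top_right])
  moreover have "\<forall>\<^sub>F t in at_right 0. inverse t ^ Suc m / exp (inverse t) = flat_exp m t / t"
    by (rule eventually_at_rightI[of 0 1]) (auto simp: flat_exp_def field_simps exp_minus)
  ultimately show "((\<lambda>t. flat_exp m t / t) \<longlongrightarrow> 0) (at_right 0)"
    by (rule Lim_transform_eventually)
  have "\<forall>\<^sub>F t in at_left 0. 0 = flat_exp m t / t"
    by (rule eventually_at_leftI[of "-1"]) (auto simp: flat_exp_def)
  then show "((\<lambda>t. flat_exp m t / t) \<longlongrightarrow> 0) (at_left 0)"
    by (rule Lim_transform_eventually[OF tendsto_const])
qed

lemma DERIV_flat_exp: "(flat_exp m has_field_derivative flat_exp (m + 2) t - real m * flat_exp (m + 1) t) (at t)"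
proof (cases t "0::real" rule: linorder_cases)
  case less
  have "((\<lambda>_. 0) has_field_derivative 0) (at t)" by simp
  then have "(flat_exp m has_field_derivative 0) (at t)"
    by (rule has_field_derivative_transform_within_open[of _ _ _ "{..<0}"])
       (use less in \<open>auto simp: flat_exp_def\<close>)
  with less show ?thesis by (simp add: flat_exp_def)
next
  case equal
  have "((\<lambda>h. (flat_exp m (0 + h) - flat_exp m 0) / h) \<longlongrightarrow> 0) (at 0)"
    using flat_exp_over_t_tendsto_0[of m] by (simp add: flat_exp_def)
  then show ?thesis by (simp add: equal DERIV_def flat_exp_def)
next
  case greater
  have "((\<lambda>t. exp (- 1 / t) / t ^ m) has_field_derivative
      flat_exp (m + 2) t - real m * flat_exp (m + 1) t) (at t)"
  proof (cases m)
    case 0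
    with greater show ?thesis
      by (auto intro!: derivative_eq_intros simp: flat_exp_def power2_eq_square)
  next
    case (Suc k)
    have "((\<lambda>t. exp (- 1 / t) / t ^ m) has_field_derivative
        (exp (- 1 / t) * (1 / t\<^sup>2) * t ^ m - exp (- 1 / t) * (real m * t ^ k)) / (t ^ m * t ^ m)) (at t)"
      using greater Suc
      by (auto intro!: derivative_eq_intros simp: power2_eq_square) (cases k; simp add: algebra_simps)
    also have "(exp (- 1 / t) * (1 / t\<^sup>2) * t ^ m - exp (- 1 / t) * (real m * t ^ k)) / (t ^ m * t ^ m)
        = flat_exp (m + 2) t - real m * flat_exp (m + 1) t"
      using greater by (simp add: flat_exp_def Suc field_simps power_add power2_eq_square)
    finally show ?thesis .
  qed
  then show ?thesis
    by (rule has_field_derivative_transform_within_open[of _ _ _ "{0<..}"])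
       (use greater in \<open>auto simp: flat_exp_def\<close>)
qed

text \<open>
  The algebra generated by the functions \<open>flat_exp m\<close> of affine functions of one coordinate. It is
  mapped into itself by every partial derivative, so its members are smooth, without any further
  analysis of higher derivatives.
\<close>

inductive smooth_algebra :: "(real^'n \<Rightarrow> real) \<Rightarrow> bool" where
  const: "smooth_algebra (\<lambda>x. c)"
| flat_exp: "smooth_algebra (\<lambda>x. flat_exp m (c * x $ i + b))"
| add: "smooth_algebra f \<Longrightarrow> smooth_algebra g \<Longrightarrow> smooth_algebra (\<lambda>x. f x + g x)"
| mult: "smooth_algebra f \<Longrightarrow> smooth_algebra g \<Longrightarrow> smooth_algebra (\<lambda>x. f x * g x)"

lemma smooth_algebra_diff: "smooth_algebra f \<Longrightarrow> smooth_algebra g \<Longrightarrow> smooth_algebra (\<lambda>x. f x - g x)"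
  using add[OF _ mult[OF const[of "-1"]], of f g] by simp

lemma smooth_algebra_prod: "(\<And>i. i \<in> I \<Longrightarrow> smooth_algebra (f i)) \<Longrightarrow> smooth_algebra (\<lambda>x. \<Prod>i\<in>I. f i x)"
  by (induction I rule: infinite_finite_induct) (auto intro: const mult)

lemma partial_eq: "(f has_derivative f') (at x) \<Longrightarrow> partial j f x = f' (axis j 1)"
  by (simp add: partial_def frechet_derivative_at[symmetric])

lemma smooth_algebra_partial:
  "smooth_algebra f \<Longrightarrow> (\<forall>x. f differentiable (at x)) \<and> (\<forall>j. smooth_algebra (partial j f))"
proof (induction rule: smooth_algebra.induct)
  case (const c)
  have "partial j (\<lambda>x. c) = (\<lambda>x. 0)" for j :: 'a
    by (rule ext, subst partial_eq) (auto intro: has_derivative_const)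
  then show ?case by (auto intro: smooth_algebra.const)
next
  case (flat_exp m c i b)
  have d: "((\<lambda>x::real^'a. flat_exp m (c * x $ i + b)) has_derivative
      (\<lambda>h. (c * h $ i) * (flat_exp (m + 2) (c * x $ i + b) - real m * flat_exp (m + 1) (c * x $ i + b)))) (at x)" for x
    by (rule has_derivative_compose[where f = "\<lambda>x. c * x $ i + b" and f' = "\<lambda>h. c * h $ i",
          OF _ DERIV_flat_exp[unfolded has_field_derivative_def], THEN has_derivative_eq_rhs])
       (auto intro!: derivative_eq_intros bounded_linear_vec_nth[THEN bounded_linear.has_derivative] simp: mult.commute)
  then have p: "partial j (\<lambda>x::real^'a. flat_exp m (c * x $ i + b)) =
      (\<lambda>x. (c * axis j 1 $ i) * (flat_exp (m + 2) (c * x $ i + b) - real m * flat_exp (m + 1) (c * x $ i + b)))" for j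
    by (intro ext partial_eq)
  show ?case unfolding p
    using d by (auto simp: differentiable_def intro!: smooth_algebra.intros smooth_algebra_diff)
next
  case (add f g)
  have d: "((\<lambda>x. f x + g x) has_derivative
      (\<lambda>h. frechet_derivative f (at x) h + frechet_derivative g (at x) h)) (at x)" for x
    using add by (intro has_derivative_add) (auto simp: frechet_derivative_works)
  have p: "partial j (\<lambda>x. f x + g x) = (\<lambda>x. partial j f x + partial j g x)" for j
    by (rule ext) (simp only: partial_eq[OF d], simp add: partial_def)
  show ?case unfolding p
    using d add by (auto simp: differentiable_def intro!: smooth_algebra.intros)
next
  case (mult f g)
  have d: "((\<lambda>x. f x * g x) has_derivative
      (\<lambda>h. f x * frechet_derivative g (at x) h + frechet_derivative f (at x) h * g x)) (at x)" for x
    using mult by (intro has_derivative_mult) (auto simp: frechet_derivative_works)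
  have p: "partial j (\<lambda>x. f x * g x) = (\<lambda>x. f x * partial j g x + partial j f x * g x)" for j
    by (rule ext) (simp only: partial_eq[OF d], simp add: partial_def)
  show ?case unfolding p
    using d mult by (auto simp: differentiable_def intro!: smooth_algebra.intros)
qed

lemma smooth_algebra_C_k: "smooth_algebra f \<Longrightarrow> C_k k f"
proof (induction k arbitrary: f)
  case 0
  then show ?case using smooth_algebra_partial[of f]
    by (auto intro!: differentiable_imp_continuous_on simp: differentiable_on_def differentiable_at_withinI)
next
  case (Suc k)
  then show ?case using smooth_algebra_partial[of f] by auto
qed

lemma flat_exp_0_bounds: "0 \<le> flat_exp 0 t" "flat_exp 0 t \<le> 1"
  by (auto simp: flat_exp_def)

lemma flat_exp_0_tendsto_1: "(flat_exp 0 \<longlongrightarrow> 1) at_top"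
proof -
  have "((\<lambda>t::real. exp (- inverse t)) \<longlongrightarrow> exp (- 0)) at_top"
    by (intro tendsto_intros tendsto_inverse_0_at_top filterlim_ident)
  moreover have "\<forall>\<^sub>F t in at_top. exp (- inverse t) = flat_exp 0 t"
    using eventually_gt_at_top[of 0] by eventually_elim (simp add: flat_exp_def divide_inverse)
  ultimately show ?thesis by (auto intro: Lim_transform_eventually)
qed

text \<open>
  For \<open>k > 0\<close> this is positive exactly where every coordinate lies in its interval, more than \<open>1/k\<close>
  away from both ends. The gap \<open>1/k\<close> keeps the support a compact subset of the open box, and \<open>flat_exp 0\<close> tends
  to \<open>1\<close> at infinity, so the functions tend to the indicator of the box.
\<close>

definition bump :: "real^'n \<Rightarrow> real^'n \<Rightarrow> nat \<Rightarrow> real^'n \<Rightarrow> real" where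
  "bump a b k x = (\<Prod>i\<in>UNIV. flat_exp 0 (real k * (x $ i - a $ i) - 1) * flat_exp 0 (real k * (b $ i - x $ i) - 1))"

lemma smooth_algebra_bump: "smooth_algebra (bump a b k)"
proof -
  have "smooth_algebra (\<lambda>x. \<Prod>i\<in>UNIV. flat_exp 0 (real k * x $ i + (- real k * a $ i - 1))
      * flat_exp 0 (- real k * x $ i + (real k * b $ i - 1)))"
    by (intro smooth_algebra_prod smooth_algebra.intros)
  also have "(\<lambda>x. \<Prod>i\<in>UNIV. flat_exp 0 (real k * x $ i + (- real k * a $ i - 1))
      * flat_exp 0 (- real k * x $ i + (real k * b $ i - 1))) = bump a b k"
    by (simp add: bump_def fun_eq_iff algebra_simps)
  finally show ?thesis .
qed

lemma bump_bounds: "0 \<le> bump a b k x" "bump a b k x \<le> 1"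
  unfolding bump_def by (auto intro!: prod_nonneg prod_le_1 mult_nonneg_nonneg mult_le_one flat_exp_0_bounds)

lemma bump_support:
  fixes a b :: "real^'n"
  shows "\<exists>K. compact K \<and> K \<subseteq> box a b \<and> {x. bump a b k x \<noteq> 0} \<subseteq> K"
proof -
  define K where "K = (\<Inter>i. {x::real^'n. 1 \<le> real k * (x $ i - a $ i)} \<inter> {x. 1 \<le> real k * (b $ i - x $ i)})"
  have pos: "0 < t" if "1 \<le> real k * t" for t
  proof (rule ccontr)
    assume "\<not> 0 < t"
    then have "real k * t \<le> 0" by (intro mult_nonneg_nonpos) auto
    with that show False by simp
  qed
  have sub: "K \<subseteq> box a b"
    using pos by (fastforce simp: K_def mem_box_cart)
  have "closed K" unfolding K_def
    by (intro closed_INT ballI closed_Int closed_Collect_le continuous_intros)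
  moreover have "bounded K" using sub bounded_box bounded_subset by blast
  ultimately have "compact K" by (simp add: compact_eq_bounded_closed)
  moreover have "{x. bump a b k x \<noteq> 0} \<subseteq> K"
  proof
    fix x assume "x \<in> {x. bump a b k x \<noteq> 0}"
    then have "flat_exp 0 (real k * (x $ i - a $ i) - 1) \<noteq> 0" "flat_exp 0 (real k * (b $ i - x $ i) - 1) \<noteq> 0" for i
      by (auto simp: bump_def)
    then have "0 < real k * (x $ i - a $ i) - 1" "0 < real k * (b $ i - x $ i) - 1" for i
      by (metis flat_exp_def)+
    then show "x \<in> K" by (auto simp: K_def less_imp_le)
  qed
  ultimately show ?thesis using sub by blast
qed

lemma bump_tendsto_1:
  fixes a b :: "real^'n"
  assumes "x \<in> box a b"
  shows "(\<lambda>k. bump a b k x) \<longlonglongrightarrow> 1"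
proof -
  have "(\<lambda>k. flat_exp 0 (real k * d - 1)) \<longlonglongrightarrow> 1" if "d > 0" for d
  proof (rule filterlim_compose[OF flat_exp_0_tendsto_1])
    have "filterlim (\<lambda>k. d * real k) at_top sequentially"
      by (rule filterlim_tendsto_pos_mult_at_top[OF tendsto_const that filterlim_real_sequentially])
    then have "filterlim (\<lambda>k. - 1 + d * real k) at_top sequentially"
      by (rule filterlim_tendsto_add_at_top[OF tendsto_const])
    then show "filterlim (\<lambda>k. real k * d - 1) at_top sequentially"
      by (simp add: algebra_simps)
  qed
  then have "(\<lambda>k. bump a b k x) \<longlonglongrightarrow> (\<Prod>i\<in>(UNIV::'n set). 1 * 1)"
    unfolding bump_def using assms by (intro tendsto_prod tendsto_mult) (auto simp: mem_box_cart)
  then show ?thesis by simp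
qed

text \<open>
  An open set is a countable union of open boxes. With bumps \<open>\<beta>\<^sub>m\<close> on the boxes, the function
  \<open>1 - (\<Prod>m<k. 1 - \<beta>\<^sub>m)\<close> stays between \<open>0\<close> and \<open>1\<close>, is supported in finitely many boxes, and tends to
  \<open>1\<close> wherever one bump does.
\<close>

lemma indicator_open_limit_test_functions:
  fixes U :: "(real^'n) set"
  assumes "open U"
  obtains \<phi> where "\<And>k::nat. test_function U (\<phi> k)" "\<And>k x. \<bar>\<phi> k x\<bar> \<le> 1"
    "\<And>x. (\<lambda>k. \<phi> k x) \<longlonglongrightarrow> indicator U x"
proof -
  obtain \<D> where D: "countable \<D>" "\<D> \<subseteq> Pow U" "\<And>X. X \<in> \<D> \<Longrightarrow> \<exists>a b. X = box a b" "\<Union>\<D> = U"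
    using open_countable_Union_open_box[OF assms] by blast
  \<comment> \<open>Adding the empty box makes the family of boxes nonempty, so that it can be enumerated.\<close>
  define B where "B = from_nat_into (insert {} \<D>)"
  have rB: "range B = insert {} \<D>" unfolding B_def using D(1) by (intro range_from_nat_into) auto
  have "\<exists>a b. B m = box a b" for m
  proof -
    have "B m \<in> insert {} \<D>" using rB by blast
    moreover have "\<exists>a b. {} = box a (b::real^'n)" by (rule exI[of _ 0])+ (auto simp: mem_box_cart)
    ultimately show ?thesis using D(3) by blast
  qed
  then obtain a b where ab: "\<And>m. B m = box (a m) (b m)" by metis
  have BU: "(\<Union>m. B m) = U" using rB D(4) by auto
  define \<phi> where "\<phi> k x = 1 - (\<Prod>m<k. 1 - bump (a m) (b m) k x)" for k x
  have P: "0 \<le> (\<Prod>m\<in>I. 1 - bump (a m) (b m) k x)" "(\<Prod>m\<in>I. 1 - bump (a m) (b m) k x) \<le> 1" for I k x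
    by (auto intro!: prod_nonneg prod_le_1 simp: bump_bounds)
  show thesis
  proof
    fix k
    obtain K where K: "\<And>m. compact (K m)" "\<And>m. K m \<subseteq> box (a m) (b m)"
        "\<And>m. {x. bump (a m) (b m) k x \<noteq> 0} \<subseteq> K m"
      using bump_support[of "a m" "b m" k for m] by metis
    define L where "L = (\<Union>m<k. K m)"
    have L: "compact L" unfolding L_def using K by (intro compact_UN) auto
    have "{x. \<phi> k x \<noteq> 0} \<subseteq> L"
    proof (rule subsetI, rule ccontr)
      fix x assume "x \<in> {x. \<phi> k x \<noteq> 0}" "x \<notin> L"
      then have "bump (a m) (b m) k x = 0" if "m < k" for m
        using K(3)[of m] that by (auto simp: L_def)
      then have "\<phi> k x = 0" by (simp add: \<phi>_def)
      with \<open>x \<in> {x. \<phi> k x \<noteq> 0}\<close> show False by simp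
    qed
    then have cl: "closure {x. \<phi> k x \<noteq> 0} \<subseteq> L"
      using L by (simp add: closure_minimal compact_imp_closed)
    have "compact (closure {x. \<phi> k x \<noteq> 0})"
      using compact_Int_closed[OF L closed_closure, of "{x. \<phi> k x \<noteq> 0}"] cl by (simp add: inf_absorb2)
    moreover have "L \<subseteq> U" using K(2) BU ab by (fastforce simp: L_def)
    moreover have "smooth_algebra (\<phi> k)" unfolding \<phi>_def
      by (intro smooth_algebra_diff smooth_algebra_prod smooth_algebra.const smooth_algebra_bump)
    ultimately show "test_function U (\<phi> k)"
      using cl smooth_algebra_C_k by (auto simp: test_function_def)
  next
    fix k x show "\<bar>\<phi> k x\<bar> \<le> 1" using P[where I="{..<k}" and k=k and x=x] by (simp add: \<phi>_def)
  next
    fix x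
    show "(\<lambda>k. \<phi> k x) \<longlonglongrightarrow> indicator U x"
    proof (cases "x \<in> U")
      case True
      then obtain m where m: "x \<in> box (a m) (b m)" using BU ab by blast
      have "(\<lambda>k. 1 - bump (a m) (b m) k x) \<longlonglongrightarrow> 0"
        using tendsto_diff[OF tendsto_const[of 1] bump_tendsto_1[OF m]] by simp
      moreover have "\<forall>\<^sub>F k in sequentially. norm (\<Prod>m<k. 1 - bump (a m) (b m) k x) \<le> 1 - bump (a m) (b m) k x"
      proof (rule eventually_sequentiallyI[of "Suc m"])
        fix k assume k: "Suc m \<le> k"
        then have "(\<Prod>m<k. 1 - bump (a m) (b m) k x)
            = (1 - bump (a m) (b m) k x) * (\<Prod>m\<in>{..<k} - {m}. 1 - bump (a m) (b m) k x)"
          by (intro prod.remove) auto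
        also have "\<dots> \<le> (1 - bump (a m) (b m) k x) * 1"
          by (intro mult_left_mono P) (simp add: bump_bounds)
        finally show "norm (\<Prod>m<k. 1 - bump (a m) (b m) k x) \<le> 1 - bump (a m) (b m) k x"
          using P(1)[where I="{..<k}" and k=k and x=x] by simp
      qed
      ultimately have "(\<lambda>k. \<Prod>m<k. 1 - bump (a m) (b m) k x) \<longlonglongrightarrow> 0"
        by (rule Lim_null_comparison[rotated])
      then have "(\<lambda>k. \<phi> k x) \<longlonglongrightarrow> 1 - 0" unfolding \<phi>_def by (intro tendsto_diff tendsto_const)
      with True show ?thesis by simp
    next
      case False
      have "bump (a m) (b m) k x = 0" for m k
        using bump_support[of "a m" "b m" k] False BU ab by blast
      with False show ?thesis by (simp add: \<phi>_def)
    qed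
  qed
qed

section \<open>Uniqueness of the weak gradient\<close>

lemma finite_measure_lebesgue_on_bounded:
  "open \<Omega> \<Longrightarrow> bounded \<Omega> \<Longrightarrow> finite_measure (lebesgue_on \<Omega>)"
  by (intro finite_measure_lebesgue_on lmeasurable_open)

text \<open>
  The fundamental lemma of the calculus of variations. Test functions approximate the indicators of
  open sets, countable intersections of open sets are decreasing limits of those, and every Lebesgue
  set agrees with such an intersection up to a null set. So \<open>g\<close> has integral zero over every set.
\<close>

lemma AE_zero_if_test_integrals_zero:
  fixes g :: "real^'n \<Rightarrow> real"
  assumes \<Omega>: "open \<Omega>" "bounded \<Omega>" and g: "integrable (lebesgue_on \<Omega>) g"
    and test: "\<And>\<phi>. test_function \<Omega> \<phi> \<Longrightarrow> (\<integral>x. g x * \<phi> x \<partial>lebesgue_on \<Omega>) = 0"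
  shows "AE x in lebesgue_on \<Omega>. g x = 0"
proof -
  let ?M = "lebesgue_on \<Omega>"
  have [measurable]: "g \<in> borel_measurable ?M" using g by simp
  have ind: "indicator A \<in> borel_measurable ?M" if "A \<in> sets lebesgue" for A :: "(real^'n) set" 
    using that by (intro measurable_restrict_space1) simp
  \<comment> \<open>Vanishing of the integrals passes to bounded pointwise limits, by dominated convergence.\<close>
  have limit: "(\<integral>x. g x * indicator A x \<partial>?M) = 0"
    if f: "\<And>k. f k \<in> borel_measurable ?M" "\<And>k x. \<bar>f k x\<bar> \<le> 1" "\<And>x. x \<in> \<Omega> \<Longrightarrow> (\<lambda>k. f k x) \<longlonglongrightarrow> indicator A x"
      "\<And>k. (\<integral>x. g x * f k x \<partial>?M) = 0" and A: "A \<in> sets lebesgue" for f :: "nat \<Rightarrow> _ \<Rightarrow> real" and A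
  proof -
    have [measurable]: "indicator A \<in> borel_measurable ?M" using ind[OF A] .
    have [measurable]: "f k \<in> borel_measurable ?M" for k using f(1) .
    have "(\<lambda>k. \<integral>x. g x * f k x \<partial>?M) \<longlonglongrightarrow> (\<integral>x. g x * indicator A x \<partial>?M)"
    proof (rule integral_dominated_convergence[where w = "\<lambda>x. norm (g x)"])
      show "AE x in ?M. (\<lambda>k. g x * f k x) \<longlonglongrightarrow> g x * indicator A x"
        by (rule AE_I2) (auto intro!: tendsto_intros f(3))
      show "AE x in ?M. norm (g x * f k x) \<le> norm (g x)" for k
        using f(2)[of k] by (auto simp: abs_mult mult_left_le)
    qed (use g in \<open>auto\<close>)
    then show ?thesis using f(4) by (simp add: LIMSEQ_const_iff)
  qed
  have op: "(\<integral>x. g x * indicator U x \<partial>?M) = 0" if U: "open U" "U \<subseteq> \<Omega>" for U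
  proof -
    obtain \<phi> where \<phi>: "\<And>k::nat. test_function U (\<phi> k)" "\<And>k x. \<bar>\<phi> k x\<bar> \<le> 1"
        "\<And>x. (\<lambda>k. \<phi> k x) \<longlonglongrightarrow> indicator U x"
      using indicator_open_limit_test_functions[OF U(1)] by metis
    show ?thesis
    proof (rule limit[of \<phi>])
      fix k
      have "continuous_on UNIV (\<phi> k)" using \<phi>(1)[of k] by (metis test_function_def C_k.simps(1))
      then show "\<phi> k \<in> borel_measurable ?M"
        by (intro measurable_restrict_space1 measurable_completion) (simp add: borel_measurable_continuous_onI)
      show "(\<integral>x. g x * \<phi> k x \<partial>?M) = 0"
        using \<phi>(1)[of k] U by (intro test) (auto simp: test_function_def)
    qed (use \<phi> U in auto)
  qed
  interpret finite_measure ?M using \<Omega> by (rule finite_measure_lebesgue_on_bounded)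
  show ?thesis
  proof (rule density_zero[OF g])
    fix A assume "A \<in> sets ?M"
    then have A: "A \<in> sets lebesgue" "A \<subseteq> \<Omega>"
      using \<Omega> by (auto simp: sets_restrict_space)
    obtain G T where GT: "gdelta G" "T \<in> null_sets lebesgue" "A \<union> T = G"
      using lebesgue_set_almost_gdelta[OF A(1)] by metis
    from GT(1) obtain F :: "nat \<Rightarrow> _" where F: "\<And>n. open (F n)" "G = (\<Inter>n. F n)"
      by (auto elim: gdelta.cases)
    define U where "U k = \<Omega> \<inter> (\<Inter>i\<le>k. F i)" for k
    have U: "open (U k)" for k unfolding U_def using \<Omega> F by (intro open_Int open_INT) auto
    have Gs: "G \<in> sets lebesgue" using GT A(1) by (metis null_setsD2 sets.Un)
    have "(\<integral>x. g x * indicator G x \<partial>?M) = 0"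
    proof (rule limit[of "\<lambda>k. indicator (U k)"])
      fix k
      show "indicator (U k) \<in> borel_measurable ?M" using U by (intro ind) simp
      show "(\<integral>x. g x * indicator (U k) x \<partial>?M) = 0" using U by (intro op) (auto simp: U_def)
    next
      fix x assume x: "x \<in> \<Omega>"
      have "\<forall>\<^sub>F k in sequentially. indicator (U k) x = (indicator G x :: real)"
      proof (cases "x \<in> G")
        case True then show ?thesis using x F by (auto simp: U_def)
      next
        case False
        then obtain n where n: "x \<notin> F n" using F by blast
        show ?thesis
        proof (rule eventually_sequentiallyI[of n])
          fix k assume "n \<le> k"
          with n have "x \<notin> U k" by (auto simp: U_def)
          with False show "indicator (U k) x = (indicator G x :: real)" by simp
        qed
      qed
      then show "(\<lambda>k. indicator (U k) x) \<longlonglongrightarrow> (indicator G x :: real)" by (rule tendsto_eventually)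
    qed (use Gs in \<open>auto simp: indicator_def\<close>)
    moreover have "(\<integral>x. g x * indicator G x \<partial>?M) = (\<integral>x. g x * indicator A x \<partial>?M)"
    proof (rule integral_cong_AE)
      have "AE x in lebesgue. x \<notin> T" using GT(2) by (rule AE_not_in)
      then have "AE x in ?M. x \<notin> T" using \<Omega> by (subst AE_restrict_space_iff) auto
      then show "AE x in ?M. g x * indicator G x = g x * indicator A x"
        by eventually_elim (use GT(3) in \<open>auto simp: indicator_def\<close>)
    qed (intro borel_measurable_times ind Gs A; simp)+
    ultimately show "set_lebesgue_integral ?M A g = 0"
      by (simp add: set_lebesgue_integral_def mult.commute)
  qed
qed


lemma test_function_continuous:
  assumes "test_function \<Omega> \<phi>"
  shows "continuous_on UNIV \<phi>" "continuous_on UNIV (partial j \<phi>)"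
  using assms unfolding test_function_def by (metis C_k.simps)+

lemma partial_test_function_support:
  assumes "test_function \<Omega> \<phi>" and x: "x \<notin> closure {x. \<phi> x \<noteq> 0}"
  shows "partial j \<phi> x = 0"
proof -
  have "((\<lambda>_. 0) has_derivative (\<lambda>_. 0)) (at x)" by simp
  then have "(\<phi> has_derivative (\<lambda>_. 0)) (at x)"
    by (rule has_derivative_transform_within_open[of _ _ _ _ "- closure {x. \<phi> x \<noteq> 0}"])
       (use x closure_subset[of "{x. \<phi> x \<noteq> 0}"] in auto)
  then show ?thesis by (rule partial_eq)
qed

lemma L2_scaled_compact_support:
  fixes \<psi> :: "real^'n \<Rightarrow> real" and c :: "'b::euclidean_space"
  assumes \<Omega>: "open \<Omega>" "bounded \<Omega>" and \<psi>: "continuous_on UNIV \<psi>" "compact K" "\<And>x. x \<notin> K \<Longrightarrow> \<psi> x = 0"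
  shows "(\<lambda>x. \<psi> x *\<^sub>R c) \<in> carr (L2 (lebesgue_on \<Omega>))"
proof -
  interpret finite_measure "lebesgue_on \<Omega>" using \<Omega> by (rule finite_measure_lebesgue_on_bounded)
  have "bounded (\<psi> ` K)"
    using \<psi> by (intro compact_imp_bounded compact_continuous_image) (auto intro: continuous_on_subset)
  then obtain B where "\<And>x. x \<in> K \<Longrightarrow> \<bar>\<psi> x\<bar> \<le> B" by (auto simp: bounded_iff)
  then have B: "\<bar>\<psi> x\<bar> \<le> \<bar>B\<bar>" for x using \<psi>(3)[of x] by (cases "x \<in> K") force+
  have [measurable]: "\<psi> \<in> borel_measurable (lebesgue_on \<Omega>)"
    using \<psi>(1) by (intro measurable_restrict_space1 measurable_completion) (simp add: borel_measurable_continuous_onI)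
  have "integrable (lebesgue_on \<Omega>) (\<lambda>x. (norm (\<psi> x *\<^sub>R c))\<^sup>2)"
  proof (rule integrable_const_bound[where B = "(\<bar>B\<bar> * norm c)\<^sup>2"])
    show "AE x in lebesgue_on \<Omega>. norm ((norm (\<psi> x *\<^sub>R c))\<^sup>2) \<le> (\<bar>B\<bar> * norm c)\<^sup>2"
      using B by (auto intro!: power_mono mult_right_mono)
  qed simp
  then show ?thesis by (simp add: mem_L2)
qed

lemma test_function_L2:
  fixes c :: "'b::euclidean_space"
  assumes "open \<Omega>" "bounded \<Omega>" "test_function \<Omega> \<phi>"
  shows "(\<lambda>x. \<phi> x *\<^sub>R c) \<in> carr (L2 (lebesgue_on \<Omega>))"
    and "(\<lambda>x. partial j \<phi> x *\<^sub>R c) \<in> carr (L2 (lebesgue_on \<Omega>))"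
proof -
  have K: "compact (closure {x. \<phi> x \<noteq> 0})" using assms(3) by (simp add: test_function_def)
  show "(\<lambda>x. \<phi> x *\<^sub>R c) \<in> carr (L2 (lebesgue_on \<Omega>))"
    using closure_subset[of "{x. \<phi> x \<noteq> 0}"]
    by (intro L2_scaled_compact_support[OF assms(1,2) test_function_continuous(1)[OF assms(3)] K]) auto
  show "(\<lambda>x. partial j \<phi> x *\<^sub>R c) \<in> carr (L2 (lebesgue_on \<Omega>))"
    by (intro L2_scaled_compact_support[OF assms(1,2) test_function_continuous(2)[OF assms(3)] K]
        partial_test_function_support[OF assms(3)])
qed

text \<open>
  Testing against a component is pairing with a fixed element of \<open>L\<^sup>2\<close>. In this form linearity and
  closedness of the weak gradient are linearity and continuity of the inner product.
\<close>

lemma weak_grad_iff_ip: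
  "weak_grad \<Omega> u G \<longleftrightarrow> G \<in> carr (L2 (lebesgue_on \<Omega>)) \<and>
    (\<forall>\<phi> i j. test_function \<Omega> \<phi> \<longrightarrow>
      ip (L2 (lebesgue_on \<Omega>)) u (\<lambda>x. partial j \<phi> x *\<^sub>R axis i 1)
        = - ip (L2 (lebesgue_on \<Omega>)) G (\<lambda>x. \<phi> x *\<^sub>R axis i (axis j 1)))"
  by (simp add: weak_grad_def ip_L2 inner_axis mult.commute)

lemma weak_grad_L2: "weak_grad \<Omega> u G \<Longrightarrow> G \<in> carr (L2 (lebesgue_on \<Omega>))"
  by (simp add: weak_grad_def)

lemma weak_grad_linear:
  assumes \<Omega>: "open \<Omega>" "bounded \<Omega>"
    and u: "u \<in> carr (L2 (lebesgue_on \<Omega>))" "weak_grad \<Omega> u G"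
    and v: "v \<in> carr (L2 (lebesgue_on \<Omega>))" "weak_grad \<Omega> v H"
  shows "weak_grad \<Omega> (a *\<^sub>R u + b *\<^sub>R v) (a *\<^sub>R G + b *\<^sub>R H)"
proof -
  have GH: "G \<in> carr (L2 (lebesgue_on \<Omega>))" "H \<in> carr (L2 (lebesgue_on \<Omega>))"
    using u v by (auto intro: weak_grad_L2)
  show ?thesis
    unfolding weak_grad_iff_ip
  proof (intro conjI allI impI L2.V_lincomb GH)
    fix \<phi> i j assume \<phi>: "test_function \<Omega> \<phi>"
    note L2s = test_function_L2[OF \<Omega> \<phi>]
    show "ip (L2 (lebesgue_on \<Omega>)) (a *\<^sub>R u + b *\<^sub>R v) (\<lambda>x. partial j \<phi> x *\<^sub>R axis i 1)
        = - ip (L2 (lebesgue_on \<Omega>)) (a *\<^sub>R G + b *\<^sub>R H) (\<lambda>x. \<phi> x *\<^sub>R axis i (axis j 1))"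
      unfolding L2.ip_lincomb_left[OF u(1) v(1) L2s(2)] L2.ip_lincomb_left[OF GH L2s(1)]
      using u(2) v(2) \<phi> by (simp add: weak_grad_iff_ip)
  qed
qed

lemma weak_grad_unique:
  assumes \<Omega>: "open \<Omega>" "bounded \<Omega>"
    and u: "u \<in> carr (L2 (lebesgue_on \<Omega>))" "weak_grad \<Omega> u G"
    and v: "v \<in> carr (L2 (lebesgue_on \<Omega>))" "weak_grad \<Omega> v H"
    and uv: "AE x in lebesgue_on \<Omega>. u x = v x"
  shows "AE x in lebesgue_on \<Omega>. G x = H x"
proof -
  let ?M = "lebesgue_on \<Omega>"
  interpret finite_measure ?M using \<Omega> by (rule finite_measure_lebesgue_on_bounded)
  have GH: "G \<in> carr (L2 ?M)" "H \<in> carr (L2 ?M)" using u v by (auto intro: weak_grad_L2)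
  have "AE x in ?M. (G - H) x \<bullet> axis i (axis j 1) = 0" for i j
  proof (rule AE_zero_if_test_integrals_zero[OF \<Omega>])
    have "(\<lambda>x. axis i (axis j 1)) \<in> carr (L2 ?M)" by (simp add: mem_L2)
    then show "integrable ?M (\<lambda>x. (G - H) x \<bullet> axis i (axis j 1))"
      by (rule L2_integrable_inner[OF L2.V_diff[OF GH]])
    fix \<phi> assume \<phi>: "test_function \<Omega> \<phi>"
    note L2s = test_function_L2[OF \<Omega> \<phi>]
    have "ip (L2 ?M) G (\<lambda>x. \<phi> x *\<^sub>R axis i (axis j 1)) = ip (L2 ?M) H (\<lambda>x. \<phi> x *\<^sub>R axis i (axis j 1))"
      using u v \<phi> L2_cong_AE[OF uv u(1) v(1) L2s(2)[of j "axis i 1"]]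
      unfolding weak_grad_iff_ip by (metis neg_equal_iff_equal)
    then have "ip (L2 ?M) (G - H) (\<lambda>x. \<phi> x *\<^sub>R axis i (axis j 1)) = 0"
      by (subst L2.ip_diff_left[OF GH L2s(1)]) simp
    then show "(\<integral>x. (G - H) x \<bullet> axis i (axis j 1) * \<phi> x \<partial>?M) = 0"
      by (simp add: ip_L2 mult.commute)
  qed
  then have "AE x in ?M. \<forall>i j. (G - H) x \<bullet> axis i (axis j 1) = 0"
    by (intro AE_all_countable[THEN iffD2] allI)
  then show ?thesis
    by eventually_elim (simp add: inner_axis vec_eq_iff)
qed

section \<open>The Sobolev space as a Hilbert space\<close>

lemma mem_H1: "u \<in> carr (H1 \<Omega>) \<longleftrightarrow> u \<in> carr (L2 (lebesgue_on \<Omega>)) \<and> (\<exists>G. weak_grad \<Omega> u G)"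
  by (simp add: H1_def)

lemma ip_H1: "ip (H1 \<Omega>) u v =
    ip (L2 (lebesgue_on \<Omega>)) u v + ip (L2 (lebesgue_on \<Omega>)) (grad \<Omega> u) (grad \<Omega> v)"
  by (simp add: H1_def)

lemma base_H1: "base (H1 \<Omega>) = lebesgue_on \<Omega>"
  by (simp add: H1_def)

lemma H1_weak_grad: "u \<in> carr (H1 \<Omega>) \<Longrightarrow> weak_grad \<Omega> u (grad \<Omega> u)"
  unfolding mem_H1 grad_def by (metis someI)

lemma H1_L2: "u \<in> carr (H1 \<Omega>) \<Longrightarrow> u \<in> carr (L2 (lebesgue_on \<Omega>))"
  "u \<in> carr (H1 \<Omega>) \<Longrightarrow> grad \<Omega> u \<in> carr (L2 (lebesgue_on \<Omega>))"
  using H1_weak_grad weak_grad_L2 mem_H1 by blast+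

text \<open>
  The function \<^const>\<open>grad\<close> picks an arbitrary weak gradient, so it is linear only almost everywhere.
\<close>

lemma H1_lincomb:
  assumes \<Omega>: "open \<Omega>" "bounded \<Omega>" and u: "u \<in> carr (H1 \<Omega>)" and v: "v \<in> carr (H1 \<Omega>)"
  shows "a *\<^sub>R u + b *\<^sub>R v \<in> carr (H1 \<Omega>)"
    and "AE x in lebesgue_on \<Omega>. grad \<Omega> (a *\<^sub>R u + b *\<^sub>R v) x = (a *\<^sub>R grad \<Omega> u + b *\<^sub>R grad \<Omega> v) x"
proof -
  have w: "weak_grad \<Omega> (a *\<^sub>R u + b *\<^sub>R v) (a *\<^sub>R grad \<Omega> u + b *\<^sub>R grad \<Omega> v)"
    using u v by (intro weak_grad_linear[OF \<Omega>] H1_L2 H1_weak_grad)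
  have L: "a *\<^sub>R u + b *\<^sub>R v \<in> carr (L2 (lebesgue_on \<Omega>))" using u v H1_L2 by blast
  show "a *\<^sub>R u + b *\<^sub>R v \<in> carr (H1 \<Omega>)" using w L by (auto simp: mem_H1)
  then show "AE x in lebesgue_on \<Omega>. grad \<Omega> (a *\<^sub>R u + b *\<^sub>R v) x = (a *\<^sub>R grad \<Omega> u + b *\<^sub>R grad \<Omega> v) x"
    using weak_grad_unique[OF \<Omega> L H1_weak_grad L w] by simp
qed

lemma H1_semi_inner:
  assumes \<Omega>: "open \<Omega>" "bounded \<Omega>"
  shows "semi_inner (carr (H1 \<Omega>)) (ip (H1 \<Omega>))"
proof
  note lin = H1_lincomb[OF \<Omega>]
  have zero: "0 \<in> carr (H1 \<Omega>)"
    by (auto simp: mem_H1 weak_grad_iff_ip L2.V_zero intro!: exI[of _ 0]) (simp add: ip_L2)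
  show "subspace (carr (H1 \<Omega>))"
    using lin(1)[of _ _ 1 1] lin(1)[OF _ zero, of _ _ 0] zero
    by (auto intro!: subspaceI)
  fix u v w c
  assume u: "u \<in> carr (H1 \<Omega>)"
  then show "0 \<le> ip (H1 \<Omega>) u u" by (simp add: ip_H1 H1_L2 L2.ip_nonneg)
  assume w: "w \<in> carr (H1 \<Omega>)"
  show "ip (H1 \<Omega>) u w = ip (H1 \<Omega>) w u" by (simp add: ip_H1 ip_L2 inner_commute)
  have g: "ip (L2 (lebesgue_on \<Omega>)) (grad \<Omega> (a *\<^sub>R u + b *\<^sub>R v)) (grad \<Omega> w)
        = a * ip (L2 (lebesgue_on \<Omega>)) (grad \<Omega> u) (grad \<Omega> w) + b * ip (L2 (lebesgue_on \<Omega>)) (grad \<Omega> v) (grad \<Omega> w)"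
    if v: "v \<in> carr (H1 \<Omega>)" for v a b
  proof -
    have GL: "a *\<^sub>R grad \<Omega> u + b *\<^sub>R grad \<Omega> v \<in> carr (L2 (lebesgue_on \<Omega>))"
      using H1_L2(2)[OF u] H1_L2(2)[OF v] by blast
    show ?thesis
      using L2_cong_AE[OF lin(2)[OF u v, of a b] H1_L2(2)[OF lin(1)[OF u v]] GL H1_L2(2)[OF w]]
        H1_L2(2)[OF u] H1_L2(2)[OF v] H1_L2(2)[OF w]
      by (simp add: L2.ip_add_left L2.ip_scale_left L2.V_scale)
  qed
  show "ip (H1 \<Omega>) (c *\<^sub>R u) w = c * ip (H1 \<Omega>) u w"
    using g[OF zero, of c 0] u w by (simp add: ip_H1 L2.ip_scale_left H1_L2 algebra_simps)
  assume v: "v \<in> carr (H1 \<Omega>)"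
  show "ip (H1 \<Omega>) (u + v) w = ip (H1 \<Omega>) u w + ip (H1 \<Omega>) v w"
    using g[OF v, of 1 1] u v w by (simp add: ip_H1 L2.ip_add_left H1_L2 algebra_simps)
qed

text \<open>
  Any weak gradient of \<open>v\<close> may replace the chosen one; for a limit, only the \<open>L\<^sup>2\<close> limit of the
  gradients is at hand.
\<close>

lemma H1_norm_diff:
  assumes \<Omega>: "open \<Omega>" "bounded \<Omega>" and u: "u \<in> carr (H1 \<Omega>)" and v: "v \<in> carr (H1 \<Omega>)"
    and GL: "weak_grad \<Omega> v G"
  shows "(nrm (H1 \<Omega>) (u - v))\<^sup>2 = (nrm (L2 (lebesgue_on \<Omega>)) (u - v))\<^sup>2
      + (nrm (L2 (lebesgue_on \<Omega>)) (grad \<Omega> u - G))\<^sup>2"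
proof -
  let ?M = "lebesgue_on \<Omega>"
  have uv: "u - v \<in> carr (H1 \<Omega>)" using H1_lincomb(1)[OF \<Omega> u v, of 1 "-1"] by simp
  have w: "weak_grad \<Omega> (u - v) (grad \<Omega> u - G)"
    using weak_grad_linear[OF \<Omega> H1_L2(1)[OF u] H1_weak_grad[OF u] H1_L2(1)[OF v] GL, of 1 "-1"] by simp
  note L = H1_L2[OF uv] weak_grad_L2[OF w]
  have ae: "AE x in ?M. grad \<Omega> (u - v) x = (grad \<Omega> u - G) x"
    using weak_grad_unique[OF \<Omega> H1_L2(1)[OF uv] H1_weak_grad[OF uv] H1_L2(1)[OF uv] w] by simp
  have "ip (L2 ?M) (grad \<Omega> (u - v)) (grad \<Omega> (u - v)) = ip (L2 ?M) (grad \<Omega> u - G) (grad \<Omega> (u - v))"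
    by (rule L2_cong_AE[OF ae L(2) L(3) L(2)])
  also have "\<dots> = ip (L2 ?M) (grad \<Omega> (u - v)) (grad \<Omega> u - G)" by (rule L2.ip_commute[OF L(3) L(2)])
  also have "\<dots> = ip (L2 ?M) (grad \<Omega> u - G) (grad \<Omega> u - G)" by (rule L2_cong_AE[OF ae L(2) L(3) L(3)])
  finally have "ip (H1 \<Omega>) (u - v) (u - v) = ip (L2 ?M) (u - v) (u - v) + ip (L2 ?M) (grad \<Omega> u - G) (grad \<Omega> u - G)"
    by (simp add: ip_H1)
  then show ?thesis
    using L2.ip_nonneg[OF L(1)] L2.ip_nonneg[OF L(3)] by (simp add: nrm_def)
qed

text \<open>
  A Cauchy sequence in \<open>H\<^sup>1\<close> has \<open>L\<^sup>2\<close> limits of its members and of their gradients, and the defining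
  relation of the weak gradient passes to these limits.
\<close>

lemma H1_semi_hilbert:
  assumes \<Omega>: "open \<Omega>" "bounded \<Omega>"
  shows "semi_hilbert (carr (H1 \<Omega>)) (ip (H1 \<Omega>))"
proof -
  let ?M = "lebesgue_on \<Omega>"
  interpret X: semi_inner "carr (H1 \<Omega>)" "ip (H1 \<Omega>)" using \<Omega> by (rule H1_semi_inner)
  have XN: "X.N = nrm (H1 \<Omega>)" using nrm_eq_N[OF H1_semi_inner[OF \<Omega>]] by simp
  show ?thesis
  proof (unfold_locales, unfold XN)
    fix s :: "nat \<Rightarrow> real^'a \<Rightarrow> real^'a"
    assume s: "\<And>n. s n \<in> carr (H1 \<Omega>)"
      and Cauchy: "\<And>e. e > 0 \<Longrightarrow> \<exists>K::nat. \<forall>m\<ge>K. \<forall>n\<ge>K. nrm (H1 \<Omega>) (s m - s n) < e"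
    have sL: "s n \<in> carr (L2 ?M)" "grad \<Omega> (s n) \<in> carr (L2 ?M)" for n using s by (auto intro: H1_L2)
    have le: "nrm (L2 ?M) (s m - s n) \<le> nrm (H1 \<Omega>) (s m - s n)"
         "nrm (L2 ?M) (grad \<Omega> (s m) - grad \<Omega> (s n)) \<le> nrm (H1 \<Omega>) (s m - s n)" for m n
    proof -
      have nn: "0 \<le> nrm (H1 \<Omega>) (s m - s n)" using X.N_nonneg[OF X.V_diff[OF s s]] XN by simp
      have "(nrm (L2 ?M) (s m - s n))\<^sup>2 \<le> (nrm (H1 \<Omega>) (s m - s n))\<^sup>2"
        "(nrm (L2 ?M) (grad \<Omega> (s m) - grad \<Omega> (s n)))\<^sup>2 \<le> (nrm (H1 \<Omega>) (s m - s n))\<^sup>2"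
        using H1_norm_diff[OF \<Omega> s s H1_weak_grad[OF s], of m n] by simp_all
      then show "nrm (L2 ?M) (s m - s n) \<le> nrm (H1 \<Omega>) (s m - s n)"
         "nrm (L2 ?M) (grad \<Omega> (s m) - grad \<Omega> (s n)) \<le> nrm (H1 \<Omega>) (s m - s n)"
        using nn power2_le_imp_le by blast+
    qed
    have "\<exists>l\<in>carr (L2 ?M). (\<lambda>n. nrm (L2 ?M) (s n - l)) \<longlonglongrightarrow> 0"
    proof (rule L2_complete[OF sL(1)])
      fix e :: real assume "e > 0"
      then obtain K where "\<And>m n. m \<ge> K \<Longrightarrow> n \<ge> K \<Longrightarrow> nrm (H1 \<Omega>) (s m - s n) < e" using Cauchy by blast
      then show "\<exists>K. \<forall>m\<ge>K. \<forall>n\<ge>K. nrm (L2 ?M) (s m - s n) < e"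
        using le_less_trans[OF le(1)] by blast
    qed
    then obtain l where l: "l \<in> carr (L2 ?M)" "(\<lambda>n. nrm (L2 ?M) (s n - l)) \<longlonglongrightarrow> 0" by blast
    have "\<exists>G\<in>carr (L2 ?M). (\<lambda>n. nrm (L2 ?M) (grad \<Omega> (s n) - G)) \<longlonglongrightarrow> 0"
    proof (rule L2_complete[OF sL(2)])
      fix e :: real assume "e > 0"
      then obtain K where "\<And>m n. m \<ge> K \<Longrightarrow> n \<ge> K \<Longrightarrow> nrm (H1 \<Omega>) (s m - s n) < e" using Cauchy by blast
      then show "\<exists>K. \<forall>m\<ge>K. \<forall>n\<ge>K. nrm (L2 ?M) (grad \<Omega> (s m) - grad \<Omega> (s n)) < e"
        using le_less_trans[OF le(2)] by blast
    qed
    then obtain G where G: "G \<in> carr (L2 ?M)" "(\<lambda>n. nrm (L2 ?M) (grad \<Omega> (s n) - G)) \<longlonglongrightarrow> 0" by blast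
    have w: "weak_grad \<Omega> l G"
      unfolding weak_grad_iff_ip
    proof (intro conjI allI impI G(1))
      fix \<phi> i j assume \<phi>: "test_function \<Omega> \<phi>"
      note L2s = test_function_L2[OF \<Omega> \<phi>]
      have "(\<lambda>n. ip (L2 ?M) (s n) (\<lambda>x. partial j \<phi> x *\<^sub>R axis i 1))
          \<longlonglongrightarrow> ip (L2 ?M) l (\<lambda>x. partial j \<phi> x *\<^sub>R axis i 1)"
        by (rule L2.ip_tendsto[OF sL(1) l(1) L2s(2) l(2)])
      moreover have "(\<lambda>n. - ip (L2 ?M) (grad \<Omega> (s n)) (\<lambda>x. \<phi> x *\<^sub>R axis i (axis j 1)))
          \<longlonglongrightarrow> - ip (L2 ?M) G (\<lambda>x. \<phi> x *\<^sub>R axis i (axis j 1))"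
        by (intro tendsto_minus L2.ip_tendsto[OF sL(2) G(1) L2s(1) G(2)])
      moreover have "ip (L2 ?M) (s n) (\<lambda>x. partial j \<phi> x *\<^sub>R axis i 1)
          = - ip (L2 ?M) (grad \<Omega> (s n)) (\<lambda>x. \<phi> x *\<^sub>R axis i (axis j 1))" for n
        using H1_weak_grad[OF s] \<phi> unfolding weak_grad_iff_ip by blast
      ultimately show "ip (L2 ?M) l (\<lambda>x. partial j \<phi> x *\<^sub>R axis i 1)
          = - ip (L2 ?M) G (\<lambda>x. \<phi> x *\<^sub>R axis i (axis j 1))"
        using LIMSEQ_unique by simp
    qed
    have lH: "l \<in> carr (H1 \<Omega>)" using w l by (auto simp: mem_H1)
    have "(\<lambda>n. (nrm (L2 ?M) (s n - l))\<^sup>2 + (nrm (L2 ?M) (grad \<Omega> (s n) - G))\<^sup>2) \<longlonglongrightarrow> 0\<^sup>2 + 0\<^sup>2"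
      by (intro tendsto_intros l G)
    then have "(\<lambda>n. (nrm (H1 \<Omega>) (s n - l))\<^sup>2) \<longlonglongrightarrow> 0"
      using H1_norm_diff[OF \<Omega> s lH w] by simp
    then have "(\<lambda>n. sqrt ((nrm (H1 \<Omega>) (s n - l))\<^sup>2)) \<longlonglongrightarrow> sqrt 0" by (rule tendsto_real_sqrt)
    moreover have "sqrt ((nrm (H1 \<Omega>) (s n - l))\<^sup>2) = nrm (H1 \<Omega>) (s n - l)" for n
      using X.N_nonneg[OF X.V_diff[OF s lH]] by (simp add: XN)
    ultimately have "(\<lambda>n. nrm (H1 \<Omega>) (s n - l)) \<longlonglongrightarrow> 0" by simp
    with lH show "\<exists>l\<in>carr (H1 \<Omega>). (\<lambda>n. nrm (H1 \<Omega>) (s n - l)) \<longlonglongrightarrow> 0" by blast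
  qed
qed

lemma H1_null_imp_eqv:
  assumes "u \<in> carr (H1 \<Omega>)" "ip (H1 \<Omega>) u u = 0"
  shows "eqv (H1 \<Omega>) u 0"
proof -
  have "ip (L2 (lebesgue_on \<Omega>)) u u = 0"
    using assms L2.ip_nonneg[OF H1_L2(1)[OF assms(1)]] L2.ip_nonneg[OF H1_L2(2)[OF assms(1)]]
    by (simp add: ip_H1)
  then have "AE x in lebesgue_on \<Omega>. u x = 0"
    by (intro L2_null_iff[OF H1_L2(1)[OF assms(1)], THEN iffD1]) (simp add: nrm_def)
  then show ?thesis unfolding eqv_def base_H1 zero_fun_apply .
qed

section \<open>Bounded operators between function spaces\<close>

lemma hilbert_space_semi_hilbert:
  assumes "hilbert_space X"
  shows "semi_hilbert (carr X) (ip X)"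
proof -
  note H = assms[unfolded hilbert_space_def]
  have "\<forall>f\<in>carr X. \<forall>g\<in>carr X. \<forall>a b. (\<lambda>x. a *\<^sub>R f x + b *\<^sub>R g x) \<in> carr X"
    using H by (elim conjE)
  then have lc: "a *\<^sub>R f + b *\<^sub>R g \<in> carr X" if "f \<in> carr X" "g \<in> carr X" for a b f g
    using that by (simp add: plus_fun_def scaleR_fun_def)
  have "\<forall>f\<in>carr X. \<forall>g\<in>carr X. \<forall>h\<in>carr X. \<forall>a b.
      ip X (\<lambda>x. a *\<^sub>R f x + b *\<^sub>R g x) h = a * ip X f h + b * ip X g h"
    using H by (elim conjE)
  then have ipl: "ip X (a *\<^sub>R f + b *\<^sub>R g) h = a * ip X f h + b * ip X g h"
    if "f \<in> carr X" "g \<in> carr X" "h \<in> carr X" for a b f g h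
    using that by (simp add: plus_fun_def scaleR_fun_def)
  have "(\<lambda>x. 0) \<in> carr X" using H by (elim conjE)
  then have zero: "0 \<in> carr X" by (simp add: zero_fun_def)
  have si: "semi_inner (carr X) (ip X)"
  proof
    show "subspace (carr X)" using lc[of _ _ 1 1] lc[OF _ zero, of _ _ 0] zero by (auto intro!: subspaceI)
  next
    fix f g h c assume f: "f \<in> carr X" and g: "g \<in> carr X" 
    show "ip X f g = ip X g f" using H f g by blast
    show "ip X (c *\<^sub>R f) g = c * ip X f g" using ipl[OF f zero g, of c 0] by simp
    assume "h \<in> carr X"
    then show "ip X (f + g) h = ip X f h + ip X g h" using ipl[OF f g, of h 1 1] by simp
  next
    fix f assume "f \<in> carr X" then show "0 \<le> ip X f f" using H by blast
  qed
  show ?thesis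
  proof (intro semi_hilbert.intro si semi_hilbert_axioms.intro, fold nrm_eq_N[OF si])
    fix s :: "nat \<Rightarrow> 'a \<Rightarrow> 'b"
    assume "\<And>n. s n \<in> carr X"
      and "\<And>e. e > 0 \<Longrightarrow> \<exists>K::nat. \<forall>m\<ge>K. \<forall>n\<ge>K. nrm X (s m - s n) < e"
    moreover have "\<forall>s. (\<forall>n::nat. s n \<in> carr X) \<longrightarrow>
         (\<forall>e>0. \<exists>N. \<forall>m\<ge>N. \<forall>n\<ge>N. nrm X (s m - s n) < e) \<longrightarrow>
         (\<exists>f\<in>carr X. (\<lambda>n. nrm X (s n - f)) \<longlonglongrightarrow> 0)"
      using H unfolding fun_diff_def by (elim conjE)
    ultimately show "\<exists>l\<in>carr X. (\<lambda>n. nrm X (s n - l)) \<longlonglongrightarrow> 0" by blast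
  qed
qed

lemma hilbert_space_null_iff:
  assumes "hilbert_space X" "f \<in> carr X" "g \<in> carr X"
  shows "nrm X (f - g) = 0 \<longleftrightarrow> eqv X f g"
proof -
  interpret X: semi_hilbert "carr X" "ip X" using assms(1) by (rule hilbert_space_semi_hilbert)
  have "f - g \<in> carr X" using assms by blast
  then have "ip X (f - g) (f - g) = 0 \<longleftrightarrow> eqv X (f - g) (\<lambda>x. 0)"
    using assms(1) unfolding hilbert_space_def by blast
  then show ?thesis by (simp add: nrm_def eqv_def)
qed

lemma bounded_operator_linear:
  assumes "bounded_operator X Y F" "f \<in> carr X" "g \<in> carr X"
  shows "eqv Y (F (a *\<^sub>R f + b *\<^sub>R g)) (a *\<^sub>R F f + b *\<^sub>R F g)"
  using assms unfolding bounded_operator_def plus_fun_def scaleR_fun_def by blast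

theorem bounded_operator_open_mapping:
  assumes X: "semi_hilbert (carr X) (ip X)" and Y: "hilbert_space Y"
    and T: "bounded_operator X Y T"
    and surj: "\<And>g. g \<in> carr Y \<Longrightarrow> \<exists>u\<in>carr X. eqv Y (T u) g"
  shows "\<exists>c. \<forall>g\<in>carr Y. \<exists>u\<in>carr X. eqv Y (T u) g \<and> nrm X u \<le> c * nrm Y g"
proof -
  interpret X: semi_hilbert "carr X" "ip X" by fact
  interpret Y: semi_hilbert "carr Y" "ip Y" using Y by (rule hilbert_space_semi_hilbert)
  have N: "X.N = nrm X" "Y.N = nrm Y"
    using nrm_eq_N[OF X.semi_inner_axioms] nrm_eq_N[OF Y.semi_inner_axioms] by auto
  obtain C where C: "\<And>f. f \<in> carr X \<Longrightarrow> nrm Y (T f) \<le> C * nrm X f"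
    using T unfolding bounded_operator_def by blast
  have Tin: "T f \<in> carr Y" if "f \<in> carr X" for f using T that unfolding bounded_operator_def by blast
  interpret T: semi_linear_operator "carr X" "ip X" "carr Y" "ip Y" T C
  proof (unfold_locales, unfold N)
    fix f g a b assume f: "f \<in> carr X" and g: "g \<in> carr X"
    show "nrm Y (T (a *\<^sub>R f + b *\<^sub>R g) - (a *\<^sub>R T f + b *\<^sub>R T g)) = 0"
      using hilbert_space_null_iff[OF Y Tin[OF X.V_lincomb[OF f g]] Y.V_lincomb[OF Tin[OF f] Tin[OF g]]]
        bounded_operator_linear[OF T f g] by simp
  qed (use C Tin in auto)
  have eqv_iff: "nrm Y (T u - g) = 0 \<longleftrightarrow> eqv Y (T u) g" if "u \<in> carr X" "g \<in> carr Y" for u g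
    using hilbert_space_null_iff[OF Y Tin] that by blast
  have "\<exists>c. \<forall>g\<in>carr Y. \<exists>u\<in>carr X. nrm Y (T u - g) = 0 \<and> nrm X u \<le> c * nrm Y g"
  proof (rule T.open_mapping[unfolded N])
    fix g assume "g \<in> carr Y"
    then show "\<exists>u\<in>carr X. nrm Y (T u - g) = 0" using surj[of g] eqv_iff by blast
  qed
  then obtain c where c: "\<And>g. g \<in> carr Y \<Longrightarrow> \<exists>u\<in>carr X. nrm Y (T u - g) = 0 \<and> nrm X u \<le> c * nrm Y g"
    by blast
  have "\<exists>u\<in>carr X. eqv Y (T u) g \<and> nrm X u \<le> c * nrm Y g" if g: "g \<in> carr Y" for g
    using c[OF g] eqv_iff[OF _ g] by blast
  then show ?thesis by blast
qed

section \<open>Lifting of boundary values\<close>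

lemma sets_surface_measure: "sets (surface_measure \<Gamma>) = sets (restrict_space borel \<Gamma>)"
  by (auto simp: surface_measure_def sets_restrict_space hausdorff_measure_def sets.sigma_sets_eq[of borel, simplified])

lemma openin_sets_surface_measure:
  "openin (top_of_set \<Gamma>) A \<Longrightarrow> A \<in> sets (surface_measure \<Gamma>)"
  by (auto simp: sets_surface_measure sets_restrict_space openin_open)

lemma trace_lincomb:
  assumes "trace_map \<Omega> T" "u \<in> carr (H1 \<Omega>)" "v \<in> carr (H1 \<Omega>)"
  shows "AE x in surface_measure (frontier \<Omega>). T (a *\<^sub>R u + b *\<^sub>R v) x = a *\<^sub>R T u x + b *\<^sub>R T v x"
proof -
  have "bounded_operator (H1 \<Omega>) (L2 (surface_measure (frontier \<Omega>))) T"
    using assms(1) by (simp add: trace_map_def)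
  from bounded_operator_linear[OF this assms(2,3), of a b]
  show ?thesis unfolding eqv_def base_L2 by simp
qed

lemma H1_D_subspace:
  assumes \<Omega>: "open \<Omega>" "bounded \<Omega>" and T: "trace_map \<Omega> T"
  shows "subspace (H1_D \<Omega> T \<Gamma>D)"
proof -
  interpret X: semi_inner "carr (H1 \<Omega>)" "ip (H1 \<Omega>)" using \<Omega> by (rule H1_semi_inner)
  have lc: "a *\<^sub>R u + b *\<^sub>R v \<in> H1_D \<Omega> T \<Gamma>D" if uv: "u \<in> H1_D \<Omega> T \<Gamma>D" "v \<in> H1_D \<Omega> T \<Gamma>D" for a b u v
  proof -
    have H: "u \<in> carr (H1 \<Omega>)" "v \<in> carr (H1 \<Omega>)"
      and z: "AE x in surface_measure (frontier \<Omega>). x \<in> \<Gamma>D \<longrightarrow> T u x = 0"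
        "AE x in surface_measure (frontier \<Omega>). x \<in> \<Gamma>D \<longrightarrow> T v x = 0"
      using uv by (auto simp: H1_D_def)
    have "AE x in surface_measure (frontier \<Omega>). x \<in> \<Gamma>D \<longrightarrow> T (a *\<^sub>R u + b *\<^sub>R v) x = 0"
      using z trace_lincomb[OF T H, of a b] by eventually_elim auto
    with X.V_lincomb[OF H] show ?thesis by (simp add: H1_D_def)
  qed
  have "AE x in surface_measure (frontier \<Omega>). T 0 x = 0"
    using trace_lincomb[OF T X.V_zero X.V_zero, of 0 0] by simp
  then have zero: "0 \<in> H1_D \<Omega> T \<Gamma>D" by (auto simp: H1_D_def)
  show ?thesis
    using lc[of _ _ 1 1] lc[OF _ zero, of _ _ 0] zero by (auto intro!: subspaceI)
qed

text \<open>
  If \<open>s n\<close> tends to \<open>l\<close>, then on \<open>\<Gamma>D\<close> the trace of \<open>l\<close> equals, up to sign, the trace of \<open>s n - l\<close>, whose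
  \<open>L\<^sup>2\<close> norm tends to zero.
\<close>

lemma H1_D_closed:
  assumes \<Omega>: "open \<Omega>" "bounded \<Omega>" and T: "trace_map \<Omega> T"
    and D: "openin (top_of_set (frontier \<Omega>)) \<Gamma>D"
    and s: "\<And>n::nat. s n \<in> H1_D \<Omega> T \<Gamma>D" and l: "l \<in> carr (H1 \<Omega>)"
    and lim: "(\<lambda>n. nrm (H1 \<Omega>) (s n - l)) \<longlonglongrightarrow> 0"
  shows "l \<in> H1_D \<Omega> T \<Gamma>D"
proof -
  let ?S = "surface_measure (frontier \<Omega>)"
  interpret X: semi_inner "carr (H1 \<Omega>)" "ip (H1 \<Omega>)" using \<Omega> by (rule H1_semi_inner)
  have bo: "bounded_operator (H1 \<Omega>) (L2 ?S) T" using T by (simp add: trace_map_def)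
  then obtain C where C: "\<And>u. u \<in> carr (H1 \<Omega>) \<Longrightarrow> nrm (L2 ?S) (T u) \<le> C * nrm (H1 \<Omega>) u"
    unfolding bounded_operator_def by blast
  have TL: "T u \<in> carr (L2 ?S)" if "u \<in> carr (H1 \<Omega>)" for u
    using bo that unfolding bounded_operator_def by blast
  have sH: "s n \<in> carr (H1 \<Omega>)" for n using s by (auto simp: H1_D_def)
  have [measurable]: "\<Gamma>D \<in> sets ?S" using D by (rule openin_sets_surface_measure)
  have [measurable]: "T l \<in> borel_measurable ?S" using TL[OF l] by (rule L2_measurable)
  define h where "h x = indicator \<Gamma>D x *\<^sub>R T l x" for x
  have h: "h \<in> carr (L2 ?S)"
    unfolding mem_L2
  proof
    show "h \<in> borel_measurable ?S" unfolding h_def by measurable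
    then show "integrable ?S (\<lambda>x. (norm (h x))\<^sup>2)"
      by (rule_tac Bochner_Integration.integrable_bound[of _ "\<lambda>x. (norm (T l x))\<^sup>2"])
         (use TL[OF l] in \<open>auto simp: mem_L2 h_def indicator_def\<close>)
  qed
  have "nrm (L2 ?S) h \<le> C * nrm (H1 \<Omega>) (s n - l)" for n
  proof -
    have d: "s n - l \<in> carr (H1 \<Omega>)" using sH l by blast
    have "AE x in ?S. T (s n - l) x = T (s n) x - T l x"
      using trace_lincomb[OF T sH l, of 1 n "-1"] by simp
    moreover have "AE x in ?S. x \<in> \<Gamma>D \<longrightarrow> T (s n) x = 0" using s by (auto simp: H1_D_def)
    ultimately have "AE x in ?S. h x \<bullet> h x \<le> T (s n - l) x \<bullet> T (s n - l) x"
      by eventually_elim (auto simp: h_def indicator_def)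
    then have "ip (L2 ?S) h h \<le> ip (L2 ?S) (T (s n - l)) (T (s n - l))"
      unfolding ip_L2 by (intro integral_mono_AE L2_integrable_inner h TL[OF d])
    then have "nrm (L2 ?S) h \<le> nrm (L2 ?S) (T (s n - l))" by (simp add: nrm_def)
    with C[OF d] show ?thesis by simp
  qed
  moreover have "(\<lambda>n. C * nrm (H1 \<Omega>) (s n - l)) \<longlonglongrightarrow> C * 0" by (intro tendsto_mult_left lim)
  ultimately have "nrm (L2 ?S) h \<le> C * 0" by (intro LIMSEQ_le_const) auto
  then have "nrm (L2 ?S) h = 0" using L2.N_nonneg[OF h] by linarith
  then have "AE x in ?S. h x = 0" using L2_null_iff[OF h] by simp
  then have "AE x in ?S. x \<in> \<Gamma>D \<longrightarrow> T l x = 0" by eventually_elim (auto simp: h_def)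
  with l show ?thesis by (simp add: H1_D_def)
qed

text \<open>
  The relation between a boundary value and its lifting, independent of any choice of an operator.
\<close>

definition lifts :: "(real^'n) set \<Rightarrow> ((real^'n \<Rightarrow> real^'n) \<Rightarrow> (real^'n \<Rightarrow> real^'n)) \<Rightarrow> (real^'n) set
    \<Rightarrow> (real^'n \<Rightarrow> real^'n) \<Rightarrow> (real^'n \<Rightarrow> real^'n) \<Rightarrow> bool" where
  "lifts \<Omega> T \<Gamma>D g w \<longleftrightarrow> w \<in> orth_compl (H1 \<Omega>) (H1_D \<Omega> T \<Gamma>D) \<and>
     (AE x in surface_measure (frontier \<Omega>). x \<in> \<Gamma>D \<longrightarrow> T w x = g x)"

text \<open>
  Subtracting from \<open>u\<close> its projection onto \<^const>\<open>H1_D\<close> does not change the trace on \<open>\<Gamma>D\<close>.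
\<close>

lemma lifts_exists:
  assumes \<Omega>: "open \<Omega>" "bounded \<Omega>" and T: "trace_map \<Omega> T"
    and D: "openin (top_of_set (frontier \<Omega>)) \<Gamma>D"
    and u: "u \<in> carr (H1 \<Omega>)" and g: "AE x in surface_measure (frontier \<Omega>). x \<in> \<Gamma>D \<longrightarrow> T u x = g x"
  shows "\<exists>w. lifts \<Omega> T \<Gamma>D g w"
proof -
  interpret X: semi_hilbert "carr (H1 \<Omega>)" "ip (H1 \<Omega>)" using \<Omega> by (rule H1_semi_hilbert)
  have sub: "H1_D \<Omega> T \<Gamma>D \<subseteq> carr (H1 \<Omega>)" by (auto simp: H1_D_def)
  obtain p where p: "p \<in> H1_D \<Omega> T \<Gamma>D" "\<And>z. z \<in> H1_D \<Omega> T \<Gamma>D \<Longrightarrow> ip (H1 \<Omega>) (u - p) z = 0"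
    using X.projection[OF H1_D_subspace[OF \<Omega> T] sub _ u]
      H1_D_closed[OF \<Omega> T D] nrm_eq_N[OF X.semi_inner_axioms] by metis
  have pH: "p \<in> carr (H1 \<Omega>)" using p sub by blast
  have "AE x in surface_measure (frontier \<Omega>). T (u - p) x = T u x - T p x"
    using trace_lincomb[OF T u pH, of 1 "-1"] by simp
  moreover have "AE x in surface_measure (frontier \<Omega>). x \<in> \<Gamma>D \<longrightarrow> T p x = 0"
    using p by (simp add: H1_D_def)
  ultimately have "AE x in surface_measure (frontier \<Omega>). x \<in> \<Gamma>D \<longrightarrow> T (u - p) x = g x"
    using g by eventually_elim simp
  then show ?thesis
    using p u pH X.V_diff unfolding lifts_def orth_compl_def by blast
qed

text \<open>
  The difference lies both in \<^const>\<open>H1_D\<close> and in its orthogonal complement.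
\<close>

lemma lifts_unique:
  assumes \<Omega>: "open \<Omega>" "bounded \<Omega>" and T: "trace_map \<Omega> T"
    and w: "lifts \<Omega> T \<Gamma>D g w" and w': "lifts \<Omega> T \<Gamma>D g' w'"
    and g: "AE x in surface_measure (frontier \<Omega>). x \<in> \<Gamma>D \<longrightarrow> g x = g' x"
  shows "eqv (H1 \<Omega>) w w'"
proof -
  interpret X: semi_inner "carr (H1 \<Omega>)" "ip (H1 \<Omega>)" using \<Omega> by (rule H1_semi_inner)
  have H: "w \<in> carr (H1 \<Omega>)" "w' \<in> carr (H1 \<Omega>)" using w w' by (auto simp: lifts_def orth_compl_def)
  then have d: "w - w' \<in> carr (H1 \<Omega>)" by blast
  have "AE x in surface_measure (frontier \<Omega>). T (w - w') x = T w x - T w' x"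
    using trace_lincomb[OF T H, of 1 "-1"] by simp
  moreover have "AE x in surface_measure (frontier \<Omega>). x \<in> \<Gamma>D \<longrightarrow> T w x = g x"
    "AE x in surface_measure (frontier \<Omega>). x \<in> \<Gamma>D \<longrightarrow> T w' x = g' x"
    using w w' by (auto simp: lifts_def)
  ultimately have "AE x in surface_measure (frontier \<Omega>). x \<in> \<Gamma>D \<longrightarrow> T (w - w') x = 0"
    using g by eventually_elim simp
  with d have "w - w' \<in> H1_D \<Omega> T \<Gamma>D" by (simp add: H1_D_def)
  then have "ip (H1 \<Omega>) w (w - w') = 0" "ip (H1 \<Omega>) w' (w - w') = 0"
    using w w' by (auto simp: lifts_def orth_compl_def)
  then have "ip (H1 \<Omega>) (w - w') (w - w') = 0" by (simp only: X.ip_diff_left[OF H d])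
  from H1_null_imp_eqv[OF d this] show ?thesis by (simp add: eqv_def)
qed

lemma lifts_lincomb:
  assumes \<Omega>: "open \<Omega>" "bounded \<Omega>" and T: "trace_map \<Omega> T"
    and w: "lifts \<Omega> T \<Gamma>D g w" and w': "lifts \<Omega> T \<Gamma>D g' w'"
  shows "lifts \<Omega> T \<Gamma>D (\<lambda>x. a *\<^sub>R g x + b *\<^sub>R g' x) (\<lambda>x. a *\<^sub>R w x + b *\<^sub>R w' x)"
proof -
  interpret X: semi_inner "carr (H1 \<Omega>)" "ip (H1 \<Omega>)" using \<Omega> by (rule H1_semi_inner)
  have H: "w \<in> carr (H1 \<Omega>)" "w' \<in> carr (H1 \<Omega>)" using w w' by (auto simp: lifts_def orth_compl_def)
  have "ip (H1 \<Omega>) (a *\<^sub>R w + b *\<^sub>R w') z = 0" if z: "z \<in> H1_D \<Omega> T \<Gamma>D" for z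
  proof -
    have "z \<in> carr (H1 \<Omega>)" using z by (simp add: H1_D_def)
    from X.ip_lincomb_left[OF H this] show ?thesis
      using w w' z by (simp add: lifts_def orth_compl_def)
  qed
  with X.V_lincomb[OF H] have o: "a *\<^sub>R w + b *\<^sub>R w' \<in> orth_compl (H1 \<Omega>) (H1_D \<Omega> T \<Gamma>D)"
    by (auto simp: orth_compl_def)
  have "AE x in surface_measure (frontier \<Omega>). x \<in> \<Gamma>D \<longrightarrow> T w x = g x"
    "AE x in surface_measure (frontier \<Omega>). x \<in> \<Gamma>D \<longrightarrow> T w' x = g' x"
    using w w' by (auto simp: lifts_def)
  then have "AE x in surface_measure (frontier \<Omega>). x \<in> \<Gamma>D \<longrightarrow>
      T (a *\<^sub>R w + b *\<^sub>R w') x = a *\<^sub>R g x + b *\<^sub>R g' x"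
    using trace_lincomb[OF T H, of a b] by eventually_elim auto
  with o show ?thesis by (simp add: lifts_def plus_fun_def scaleR_fun_def)
qed

text \<open>
  The vector \<open>u - w\<close> lies in \<^const>\<open>H1_D\<close>, so \<open>w\<close> is the orthogonal projection of \<open>u\<close> onto the complement,
  and projections do not increase the norm.
\<close>

lemma lifts_minimal:
  assumes \<Omega>: "open \<Omega>" "bounded \<Omega>" and T: "trace_map \<Omega> T"
    and w: "lifts \<Omega> T \<Gamma>D g w" and u: "u \<in> carr (H1 \<Omega>)"
    and g: "AE x in surface_measure (frontier \<Omega>). x \<in> \<Gamma>D \<longrightarrow> T u x = g x"
  shows "nrm (H1 \<Omega>) w \<le> nrm (H1 \<Omega>) u"
proof -
  interpret X: semi_inner "carr (H1 \<Omega>)" "ip (H1 \<Omega>)" using \<Omega> by (rule H1_semi_inner)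
  have N: "X.N = nrm (H1 \<Omega>)" using nrm_eq_N[OF X.semi_inner_axioms] by simp
  have H: "w \<in> carr (H1 \<Omega>)" using w by (auto simp: lifts_def orth_compl_def)
  have d: "u - w \<in> carr (H1 \<Omega>)" using u H by blast
  have "AE x in surface_measure (frontier \<Omega>). T (u - w) x = T u x - T w x"
    using trace_lincomb[OF T u H, of 1 "-1"] by simp
  moreover have "AE x in surface_measure (frontier \<Omega>). x \<in> \<Gamma>D \<longrightarrow> T w x = g x"
    using w by (auto simp: lifts_def)
  ultimately have "AE x in surface_measure (frontier \<Omega>). x \<in> \<Gamma>D \<longrightarrow> T (u - w) x = 0"
    using g by eventually_elim simp
  with d have "u - w \<in> H1_D \<Omega> T \<Gamma>D" by (simp add: H1_D_def)
  then have "ip (H1 \<Omega>) w (u - w) = 0" using w by (auto simp: lifts_def orth_compl_def)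
  then have "ip (H1 \<Omega>) w w = ip (H1 \<Omega>) w u" by (simp add: X.ip_diff_right[OF u H H])
  then have "X.N w * X.N w \<le> X.N w * X.N u"
    using X.Cauchy_Schwarz[OF H u] X.N_sq[OF H] by (simp add: power2_eq_square)
  then have "X.N w \<le> X.N u"
    using X.N_nonneg[OF H] X.N_nonneg[OF u] by (cases "X.N w = 0") (auto simp: mult_le_cancel_left)
  then show ?thesis by (simp add: N)
qed

theorem lemma2p5:
  fixes \<Omega> \<Gamma>D \<Gamma>N :: "(real^'n) set"
    and T0 :: "(real^'n \<Rightarrow> real^'n) \<Rightarrow> (real^'n \<Rightarrow> real^'n)"
    and Hhalf :: "(real^'n, real^'n) ip_space"
  assumes "open \<Omega>" and "connected \<Omega>" and "bounded \<Omega>" and "\<Omega> \<noteq> {}"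
    and "lipschitz_boundary \<Omega>"
    and "openin (top_of_set (frontier \<Omega>)) \<Gamma>D"
    and "openin (top_of_set (frontier \<Omega>)) \<Gamma>N"
    and "frontier \<Omega> = closure \<Gamma>D \<union> closure \<Gamma>N"
    and "\<Gamma>D \<inter> \<Gamma>N = {}"
    and "trace_map \<Omega> T0"
    and "trace_space \<Omega> T0 Hhalf"
  shows "\<exists>F. dirichlet_lifting \<Omega> T0 \<Gamma>D Hhalf F \<and>
             (\<forall>F'. dirichlet_lifting \<Omega> T0 \<Gamma>D Hhalf F' \<longrightarrow>
                   (\<forall>g\<in>carr Hhalf. eqv (H1 \<Omega>) (F' g) (F g)))"
proof -
  let ?S = "surface_measure (frontier \<Omega>)"
  note \<Omega> = \<open>open \<Omega>\<close> \<open>bounded \<Omega>\<close> and T = \<open>trace_map \<Omega> T0\<close>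
    and D = \<open>openin (top_of_set (frontier \<Omega>)) \<Gamma>D\<close>
  have baseY: "base Hhalf = ?S" and hY: "hilbert_space Hhalf" and bT: "bounded_operator (H1 \<Omega>) Hhalf T0"
    and carrY: "\<And>g. g \<in> carr Hhalf \<Longrightarrow> \<exists>u\<in>carr (H1 \<Omega>). AE x in ?S. g x = T0 u x"
    using \<open>trace_space \<Omega> T0 Hhalf\<close> by (auto simp: trace_space_def)
  interpret Y: semi_hilbert "carr Hhalf" "ip Hhalf" using hY by (rule hilbert_space_semi_hilbert)
  \<comment> \<open>Any choice of liftings is linear up to null sets, by uniqueness of the lifting.\<close>
  define F where "F g = (SOME w. lifts \<Omega> T0 \<Gamma>D g w)" for g
  have F: "lifts \<Omega> T0 \<Gamma>D g (F g)" if g: "g \<in> carr Hhalf" for g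
  proof -
    obtain u where u: "u \<in> carr (H1 \<Omega>)" "AE x in ?S. g x = T0 u x" using carrY[OF g] by blast
    from u(2) have "AE x in ?S. x \<in> \<Gamma>D \<longrightarrow> T0 u x = g x" by eventually_elim simp
    then have "\<exists>w. lifts \<Omega> T0 \<Gamma>D g w" by (rule lifts_exists[OF \<Omega> T D u(1)])
    then show ?thesis unfolding F_def by (rule someI_ex)
  qed
  have "\<exists>u\<in>carr (H1 \<Omega>). eqv Hhalf (T0 u) g" if "g \<in> carr Hhalf" for g
    using carrY[OF that] unfolding eqv_def baseY by (simp only: eq_commute)
  then obtain c where c: "\<And>g. g \<in> carr Hhalf \<Longrightarrow>
      \<exists>u\<in>carr (H1 \<Omega>). eqv Hhalf (T0 u) g \<and> nrm (H1 \<Omega>) u \<le> c * nrm Hhalf g"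
    using bounded_operator_open_mapping[OF H1_semi_hilbert[OF \<Omega>] hY bT] by blast
  have base_perp: "base (H1_D_perp \<Omega> T0 \<Gamma>D) = base (H1 \<Omega>)" by (simp add: H1_D_perp_def)
  have perp: "carr (H1_D_perp \<Omega> T0 \<Gamma>D) = orth_compl (H1 \<Omega>) (H1_D \<Omega> T0 \<Gamma>D)"
    "eqv (H1_D_perp \<Omega> T0 \<Gamma>D) = eqv (H1 \<Omega>)" "nrm (H1_D_perp \<Omega> T0 \<Gamma>D) = nrm (H1 \<Omega>)"
    by (simp add: H1_D_perp_def, intro ext, simp only: eqv_def base_perp, simp add: H1_D_perp_def nrm_def fun_eq_iff)
  have "bounded_operator Hhalf (H1_D_perp \<Omega> T0 \<Gamma>D) F"
    unfolding bounded_operator_def perp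
  proof (intro conjI ballI allI impI)
    fix f assume "f \<in> carr Hhalf"
    then show "F f \<in> orth_compl (H1 \<Omega>) (H1_D \<Omega> T0 \<Gamma>D)" using F by (simp add: lifts_def)
  next
    fix f g assume f: "f \<in> carr Hhalf" and g: "g \<in> carr Hhalf" and fg: "eqv Hhalf f g"
    have "AE x in ?S. x \<in> \<Gamma>D \<longrightarrow> f x = g x" using fg unfolding eqv_def baseY by eventually_elim simp
    then show "eqv (H1 \<Omega>) (F f) (F g)" by (rule lifts_unique[OF \<Omega> T F[OF f] F[OF g]])
  next
    fix f g and a b :: real assume f: "f \<in> carr Hhalf" and g: "g \<in> carr Hhalf"
    have fg: "(\<lambda>x. a *\<^sub>R f x + b *\<^sub>R g x) \<in> carr Hhalf"
      using Y.V_lincomb[OF f g, of a b] by (simp add: plus_fun_def scaleR_fun_def)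
    show "eqv (H1 \<Omega>) (F (\<lambda>x. a *\<^sub>R f x + b *\<^sub>R g x)) (\<lambda>x. a *\<^sub>R F f x + b *\<^sub>R F g x)"
      by (rule lifts_unique[OF \<Omega> T F[OF fg] lifts_lincomb[OF \<Omega> T F[OF f] F[OF g]]]) simp
  next
    have "nrm (H1 \<Omega>) (F g) \<le> c * nrm Hhalf g" if g: "g \<in> carr Hhalf" for g
    proof -
      obtain u where u: "u \<in> carr (H1 \<Omega>)" "eqv Hhalf (T0 u) g" "nrm (H1 \<Omega>) u \<le> c * nrm Hhalf g"
        using c[OF g] by blast
      have "AE x in ?S. x \<in> \<Gamma>D \<longrightarrow> T0 u x = g x"
        using u(2) unfolding eqv_def baseY by eventually_elim simp
      then have "nrm (H1 \<Omega>) (F g) \<le> nrm (H1 \<Omega>) u"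
        by (rule lifts_minimal[OF \<Omega> T F[OF g] u(1)])
      with u(3) show ?thesis by linarith
    qed
    then show "\<exists>C. \<forall>g\<in>carr Hhalf. nrm (H1 \<Omega>) (F g) \<le> C * nrm Hhalf g" by blast
  qed
  then have "dirichlet_lifting \<Omega> T0 \<Gamma>D Hhalf F"
    using F by (simp add: dirichlet_lifting_def lifts_def)
  moreover have "eqv (H1 \<Omega>) (F' g) (F g)"
    if F': "dirichlet_lifting \<Omega> T0 \<Gamma>D Hhalf F'" and g: "g \<in> carr Hhalf" for F' g
  proof -
    have "F' g \<in> carr (H1_D_perp \<Omega> T0 \<Gamma>D)"
      using F' g unfolding dirichlet_lifting_def bounded_operator_def by blast
    then have "lifts \<Omega> T0 \<Gamma>D g (F' g)"
      using F' g by (simp add: dirichlet_lifting_def lifts_def perp)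
    then show ?thesis by (rule lifts_unique[OF \<Omega> T _ F[OF g]]) simp
  qed
  ultimately show ?thesis by blast
qed

end
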